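(* Let $v\in\mathbb{C}$ with $v\notin(-i\infty,-i]\cup[i,i\infty)$, and let $r=\frac{v}{1+\sqrt{1+v^2}}$. Then $$\begin{aligned}\mathrm{TS}(v,1)=\;&\frac{\pi}{2}\int_0^v\frac{\tan^{-1}(u)}{u}\,du-\frac14\mathrm{Li}_3(r^2)-2\mathrm{Li}_3(1-r)-2\mathrm{Li}_3\left(\frac{r}{1+r}\right)+2\zeta(3)\\&+\frac12\log\left(\frac{1+r}{1-r}\right)\mathrm{Li}_2(r^2)+\frac{\pi^2}{3}\log(1-r)+\frac13\log^3(1+r)-\log(r)\log^2(1-r).\end{aligned}$$ Moreover, $$\mathrm{TS}(2,1)=\frac{\pi}{2}\int_0^2\frac{\tan^{-1}(u)}{u}\,du-\frac75\zeta(3).$$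
   Context: The function $\mathrm{TS}$ is $\mathrm{TS}(v,w)=\int_0^1\frac{\tan^{-1}(vx)\sin^{-1}(wx)}{x}\,dx$. The polylogarithm is $\mathrm{Li}_k(z)=\sum_{n\ge1}z^n/n^k$ for $|z|<1$, continued analytically to $\mathbb{C}\setminus[1,\infty)$ (principal branch) and with $\mathrm{Li}_3(1)=\zeta(3)$; $\log$ and square roots are principal; $(-i\infty,-i]\cup[i,i\infty)=\{it:t\in\mathbb{R},|t|\ge1\}$. For $v$ in the stated domain one has $|r|<1$. When $r\in(-1,0]$ the individual terms $\mathrm{Li}_3(1-r)$ and $\log(r)$ are multivalued (or singular), but the right-hand side minus $\frac{\pi}{2}\int_0^v\frac{\tan^{-1}(u)}{u}du$ is, as a function of $r$, single valued, analytic and odd on $|r|<1$; for such $r$ its value is taken to be that of this analytic function (i.e. determined by oddness, with value $0$ at $r=0$). *)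

theory Defs
  imports "HOL-Complex_Analysis.Complex_Analysis"
begin

definition TS :: "complex \<Rightarrow> complex \<Rightarrow> complex" where
  "TS v w = integral {0..1}
     (\<lambda>x::real. Arctan (v * of_real x) * Arcsin (w * of_real x) / of_real x)"

text \<open>The value \<open>\<zeta>(k)\<close> at an integer \<open>k \<ge> 2\<close>; the series diverges for smaller \<open>k\<close>.\<close>

definition zeta_nat :: "nat \<Rightarrow> complex" where
  "zeta_nat k = (\<Sum>n. 1 / of_nat (Suc n) ^ k)"

text \<open>
  The principal branch of the polylogarithm: the analytic continuation of the defining
  power series from the unit disc to the complex plane slit along \<open>[1,\<infinity>)\<close>. The slit plane is
  connected, so the value of the continuation at a point is unique. At \<open>z = 1\<close> (meaningful
  for \<open>k \<ge> 2\<close>) the value is \<open>\<zeta>(k)\<close>; on \<open>(1,\<infinity>)\<close> the function is left unspecified.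
\<close>

definition polylog :: "nat \<Rightarrow> complex \<Rightarrow> complex" where
  "polylog k z =
     (if z = 1 then zeta_nat k
      else (THE y. z \<notin> complex_of_real ` {1..} \<and>
              (\<exists>f. f holomorphic_on - (complex_of_real ` {1..}) \<and>
                   (\<forall>u\<in>ball 0 1. (\<lambda>n. u ^ Suc n / of_nat (Suc n) ^ k) sums f u) \<and>
                   y = f z)))"

text \<open>
  Let \<open>F\<close> be given by a formula in principal branches that need not be meaningful on \<open>(-1,0]\<close>,
  but that extends to an odd analytic function on the unit disc. Then \<open>odd_disc_value F\<close> is
  \<open>F\<close> itself off the slit, and on the slit it is that (necessarily unique) odd analytic function;
  so there it is \<open>0\<close> at \<open>0\<close> and \<open>- F (- r)\<close> at \<open>-1 < r < 0\<close>.
\<close>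

definition odd_disc_value :: "(complex \<Rightarrow> complex) \<Rightarrow> complex \<Rightarrow> complex" where
  "odd_disc_value F r =
     (if r \<notin> complex_of_real ` {-1<..0} then F r
      else (THE y. \<exists>g. g holomorphic_on ball 0 1 \<and>
                       (\<forall>z\<in>ball 0 1. g (- z) = - g z) \<and>
                       (\<forall>z\<in>ball 0 1 - complex_of_real ` {-1<..0}. g z = F z) \<and>
                       y = g r))"

end

theory Submission
  imports Defs "HOL-Real_Asymp.Real_Asymp"
begin

text \<open>
  Write \<open>v = 2r / (1 - r\<^sup>2)\<close>, a bijection between \<open>|r| < 1\<close> and the slit domain of \<open>v\<close>. The
  difference \<open>K(v) = TS(v,1) - \<pi>/2 \<integral>\<^sub>0\<^sup>v arctan u / u du\<close> equals
  \<open>\<integral>\<^sub>0\<^sup>1 (arcsin t - \<pi>/2) arctan(vt)/t dt\<close>. Differentiating under the integral, substituting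
  \<open>t = sin s\<close> and integrating by parts gives \<open>v K'(v) = - H(v)\<close> with
  \<open>H(v) = \<integral>\<^sub>0\<^bsup>\<pi>/2\<^esup> arctan(v sin s) ds\<close>. In the variable \<open>r\<close> one has
  \<open>dH/dr = log((1 + r)/(1 - r))/r\<close>, so \<open>H = Li\<^sub>2(r) - Li\<^sub>2(-r)\<close>. The reflection, Landen and
  duplication formulas for \<open>Li\<^sub>2\<close> show that the right-hand side has the same derivative in \<open>r\<close>
  on the disc slit along \<open>(-1,0]\<close>, and both sides tend to \<open>0\<close> as \<open>r \<rightarrow> 0+\<close>. As \<open>K\<close> is odd and
  holomorphic on the whole disc, it is the continuation across the slit.

  For \<open>v = 2\<close>, \<open>r\<close> is the inverse golden ratio. Then \<open>r\<^sup>2 = 1 - r = r/(1 + r)\<close>, and the functional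
  equations evaluate \<open>Li\<^sub>2(r\<^sup>2)\<close> and \<open>Li\<^sub>3(r\<^sup>2)\<close>.
\<close>

section \<open>Polylogarithms on the slit plane\<close>

definition slit_plane :: "complex set" where
  "slit_plane = - (complex_of_real ` {1..})"

lemma mem_slit_plane: "z \<in> slit_plane \<longleftrightarrow> (Im z = 0 \<longrightarrow> Re z < 1)"
proof -
  have "z \<in> complex_of_real ` {1..} \<longleftrightarrow> Im z = 0 \<and> Re z \<ge> 1"
    by (auto simp: complex_eq_iff image_iff)
  then show ?thesis by (simp add: slit_plane_def not_le)
qed

lemma open_slit_plane: "open slit_plane"
proof -
  have "closed (complex_of_real ` {1..})"
    by (rule closed_injective_linear_image)
       (auto intro!: bounded_linear.linear bounded_linear_of_real injI)
  then show ?thesis by (simp add: slit_plane_def open_Compl)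
qed

lemma closed_segment_slit_plane:
  assumes "z \<in> slit_plane" shows "closed_segment 0 z \<subseteq> slit_plane"
proof
  fix w assume "w \<in> closed_segment 0 z"
  then obtain u where u: "0 \<le> u" "u \<le> 1" "w = of_real u * z"
    by (auto simp: in_segment scaleR_conv_of_real)
  have "u * Re z < 1" if "u * Im z = 0"
  proof (cases "u = 0")
    case False
    then have "Re z < 1" using that assms by (simp add: mem_slit_plane)
    then have "u * Re z < u * 1" using u False by (intro mult_strict_left_mono) auto
    then show ?thesis using u by simp
  qed simp
  then show "w \<in> slit_plane" using u by (simp add: mem_slit_plane)
qed

lemma zero_in_slit_plane: "0 \<in> slit_plane"
  by (simp add: mem_slit_plane)

text \<open>Being starlike about 0 serves twice: it gives primitives of holomorphic functions, and
  connectedness for the identity theorem.\<close>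

lemma starlike_slit_plane: "starlike slit_plane"
  unfolding starlike_def using closed_segment_slit_plane zero_in_slit_plane by blast

lemma ball_subset_slit_plane: "ball 0 1 \<subseteq> slit_plane"
proof
  fix z :: complex assume "z \<in> ball 0 1"
  then have "Re z < 1" using complex_Re_le_cmod[of z] by simp
  then show "z \<in> slit_plane" by (simp add: mem_slit_plane)
qed

text \<open>The inductive step of the continuation, Li_(k+1)' = Li_k / z. Since
  \<open>f 0 = 0\<close>, the quotient f(z)/z has a removable singularity and hence a primitive on
  the starlike slit plane. Normalised to vanish at 0, this primitive agrees on the unit disc with
  the termwise integrated series.\<close>

lemma polylog_primitive:
  assumes f: "f holomorphic_on slit_plane"
    and s: "\<forall>u\<in>ball 0 1. (\<lambda>n. u ^ Suc n / of_nat (Suc n) ^ k) sums f u"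
  shows "\<exists>G. G holomorphic_on slit_plane \<and>
    (\<forall>u\<in>ball 0 1. (\<lambda>n. u ^ Suc n / of_nat (Suc n) ^ Suc k) sums G u) \<and>
    (\<forall>z\<in>slit_plane - {0}. (G has_field_derivative f z / z) (at z))"
proof -
  have f0: "f 0 = 0"
    using bspec[OF s, of 0] sums_unique2[of "\<lambda>n. 0" "f 0" 0] by simp
  \<comment> \<open>The removable singularity is filled with the value that
    \<open>pole_lemma_open\<close> prescribes.\<close>
  define q where "q z = (if z = 0 then deriv f 0 else f z / z)" for z
  have q: "q holomorphic_on slit_plane"
    using pole_lemma_open[OF f open_slit_plane, of 0]
    by (simp only: f0 q_def[abs_def] diff_zero)
  obtain G0 where G0: "\<And>x. x \<in> slit_plane \<Longrightarrow> (G0 has_field_derivative q x) (at x)"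
    using holomorphic_starlike_primitive[OF holomorphic_on_imp_continuous_on[OF q]
      starlike_slit_plane open_slit_plane, of "{}"] q
    by (auto simp: holomorphic_on_open open_slit_plane field_differentiable_def)
  define G where "G z = G0 z - G0 0" for z
  have G: "(G has_field_derivative q x) (at x)" if "x \<in> slit_plane" for x
    unfolding G_def using G0[OF that] by (auto intro!: derivative_eq_intros)
  \<comment> \<open>With index shift and \<open>c 0 = 0\<close>, \<open>diffs c\<close> is exactly
    the coefficient sequence of weight \<open>k\<close>, so termwise differentiation of
    \<open>S\<close> returns the series of f(z)/z.\<close>
  define c :: "nat \<Rightarrow> complex" where "c n = (if n = 0 then 0 else 1 / of_nat n ^ Suc k)" for n
  have dc: "diffs c = (\<lambda>n. 1 / of_nat (Suc n) ^ k)"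
    by (auto simp: diffs_def c_def fun_eq_iff field_simps simp del: of_nat_Suc)
  have sm: "summable (\<lambda>n. c n * z ^ n)" if "norm z < 1" for z
  proof (rule summable_comparison_test'[of "\<lambda>n. norm z ^ n" 0])
    show "summable (\<lambda>n. norm z ^ n)" using that by (intro summable_geometric) auto
    fix n :: nat
    have "norm (c n) \<le> 1"
    proof (cases n)
      case (Suc m)
      have "1 \<le> real (Suc m) ^ Suc k" by (rule one_le_power) simp
      then show ?thesis
        by (simp add: Suc c_def norm_divide norm_power del: of_nat_Suc power_Suc)
    qed (simp add: c_def)
    then show "norm (c n * z ^ n) \<le> norm z ^ n"
      by (simp add: norm_mult norm_power mult_left_le_one_le)
  qed
  define S where "S z = (\<Sum>n. c n * z ^ n)" for z
  have S0: "S 0 = 0"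
    unfolding S_def using powser_zero[of c] by (simp add: c_def)
  have Ssums: "(\<lambda>n. u ^ Suc n / of_nat (Suc n) ^ Suc k) sums S u" if "u \<in> ball 0 1" for u
  proof -
    have "(\<lambda>n. c n * u ^ n) sums S u"
      unfolding S_def using sm that by (simp add: summable_sums)
    then have "(\<lambda>n. c (Suc n) * u ^ Suc n) sums (S u - c 0 * u ^ 0)"
      by (subst sums_Suc_iff) simp
    then show ?thesis by (simp add: c_def del: of_nat_Suc power_Suc)
  qed
  have SD: "(S has_field_derivative (\<Sum>n. diffs c n * z ^ n)) (at z)" if "norm z < 1" for z
    unfolding S_def[abs_def] using sm that by (rule termdiffs_strong'[of 1])
  have SD': "(S has_field_derivative q z) (at z)" if z: "norm z < 1" "z \<noteq> 0" for z
  proof -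
    have "(\<lambda>n. z ^ Suc n / of_nat (Suc n) ^ k / z) sums (f z / z)"
      using bspec[OF s, of z] z by (intro sums_divide) auto
    then have "(\<lambda>n. diffs c n * z ^ n) sums q z"
      using z by (simp add: dc q_def del: of_nat_Suc)
    then have "(\<Sum>n. diffs c n * z ^ n) = q z" by (rule sums_unique[symmetric])
    then show ?thesis using SD[OF z(1)] by simp
  qed
  have cont: "continuous_on (ball 0 1) (\<lambda>z. G z - S z)"
  proof (intro continuous_at_imp_continuous_on ballI continuous_intros)
    fix x :: complex assume x: "x \<in> ball 0 1"
    show "isCont G x" using G x ball_subset_slit_plane by (blast intro: DERIV_isCont)
    show "isCont S x" using SD x by (auto intro: DERIV_isCont)
  qed
  \<comment> \<open>The derivatives are compared only away from 0, where division by z is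
    meaningful; continuity takes care of the exceptional point.\<close>
  obtain d where d: "\<And>z. z \<in> ball 0 1 \<Longrightarrow> G z - S z = d"
  proof (rule DERIV_zero_connected_constant[of "ball 0 (1::real) :: complex set" "{0}" "\<lambda>z. G z - S z"])
    show "\<forall>x\<in>ball 0 1 - {0}. DERIV (\<lambda>z. G z - S z) x :> 0"
    proof
      fix x :: complex assume "x \<in> ball 0 1 - {0}"
      then show "DERIV (\<lambda>z. G z - S z) x :> 0"
        using DERIV_diff[OF G[of x] SD'[of x]] ball_subset_slit_plane by auto
    qed
  qed (use cont in auto)
  have "d = 0" using d[of 0] by (simp add: S0 G_def)
  then have "\<forall>u\<in>ball 0 1. (\<lambda>n. u ^ Suc n / of_nat (Suc n) ^ Suc k) sums G u"
    using d Ssums by simp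
  moreover have "\<forall>z\<in>slit_plane - {0}. (G has_field_derivative f z / z) (at z)"
  proof
    fix z assume "z \<in> slit_plane - {0}"
    then show "(G has_field_derivative f z / z) (at z)" using G[of z] by (simp add: q_def)
  qed
  moreover have "G holomorphic_on slit_plane"
    using G by (auto simp: holomorphic_on_open open_slit_plane)
  ultimately show ?thesis by (intro exI[of _ G] conjI)
qed

text \<open>Weight 0 is the geometric series; it starts the induction on the weight.\<close>

lemma polylog_0_series:
  "(\<lambda>z. z / (1 - z)) holomorphic_on slit_plane"
  "\<forall>u\<in>ball 0 1. (\<lambda>n. u ^ Suc n / complex_of_nat (Suc n) ^ 0) sums (u / (1 - u))"
proof -
  show "(\<lambda>z. z / (1 - z)) holomorphic_on slit_plane"
    by (intro holomorphic_intros) (auto simp: mem_slit_plane)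
  show "\<forall>u\<in>ball 0 1. (\<lambda>n. u ^ Suc n / complex_of_nat (Suc n) ^ 0) sums (u / (1 - u))"
  proof
    fix u :: complex assume "u \<in> ball 0 1"
    then show "(\<lambda>n. u ^ Suc n / of_nat (Suc n) ^ 0) sums (u / (1 - u))"
      using sums_mult[OF geometric_sums[of u], of u] by simp
  qed
qed

lemma polylog_exists:
  "\<exists>f. f holomorphic_on slit_plane \<and>
       (\<forall>u\<in>ball 0 1. (\<lambda>n. u ^ Suc n / of_nat (Suc n) ^ k) sums f u)"
proof (induction k)
  case 0
  show ?case using polylog_0_series by (intro exI conjI)
next
  case (Suc k)
  then obtain f where "f holomorphic_on slit_plane"
    "\<forall>u\<in>ball 0 1. (\<lambda>n. u ^ Suc n / of_nat (Suc n) ^ k) sums f u"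
    by (elim exE conjE)
  from polylog_primitive[OF this] show ?case by (elim exE conjE, intro exI conjI)
qed

text \<open>By the identity theorem two continuations agreeing on the unit disc agree on the
  connected slit plane. This discharges the definite description in \<open>polylog\<close>: any
  continuation at hand may be used to compute it.\<close>

lemma polylog_unique:
  assumes f: "f holomorphic_on slit_plane"
    and s: "\<forall>u\<in>ball 0 1. (\<lambda>n. u ^ Suc n / of_nat (Suc n) ^ k) sums f u"
    and z: "z \<in> slit_plane"
  shows "polylog k z = f z"
proof -
  have "h z = f z" if h: "h holomorphic_on slit_plane"
    and hs: "\<forall>u\<in>ball 0 1. (\<lambda>n. u ^ Suc n / of_nat (Suc n) ^ k) sums h u" for h
  proof (rule analytic_continuation_open[of "ball 0 1" slit_plane h f])
    show "connected slit_plane" using starlike_slit_plane by (rule starlike_imp_connected)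
    show "h w = f w" if "w \<in> ball 0 1" for w
      using hs s that sums_unique2 by blast
  qed (use f h z open_slit_plane ball_subset_slit_plane in auto)
  moreover have "z \<noteq> 1" using z by (auto simp: mem_slit_plane)
  moreover have "z \<notin> complex_of_real ` {1..}"
    using z by (simp add: slit_plane_def)
  moreover have "(THE y. z \<notin> complex_of_real ` {1..} \<and>
      (\<exists>h. h holomorphic_on slit_plane \<and>
           (\<forall>u\<in>ball 0 1. (\<lambda>n. u ^ Suc n / of_nat (Suc n) ^ k) sums h u) \<and> y = h z)) = f z"
  proof (rule the_equality)
    show "z \<notin> complex_of_real ` {1..} \<and>
      (\<exists>h. h holomorphic_on slit_plane \<and>
           (\<forall>u\<in>ball 0 1. (\<lambda>n. u ^ Suc n / of_nat (Suc n) ^ k) sums h u) \<and> f z = h z)"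
      using f s z by (auto simp only: slit_plane_def Compl_iff)
  qed (use calculation in blast)
  ultimately show ?thesis by (simp only: polylog_def slit_plane_def if_False)
qed

lemma polylog_holomorphic: "polylog k holomorphic_on slit_plane" (is ?A)
  and polylog_sums: "u \<in> ball 0 1 \<Longrightarrow> (\<lambda>n. u ^ Suc n / of_nat (Suc n) ^ k) sums polylog k u"
proof -
  obtain f where f: "f holomorphic_on slit_plane"
    and s: "\<forall>u\<in>ball 0 1. (\<lambda>n. u ^ Suc n / of_nat (Suc n) ^ k) sums f u"
    using polylog_exists by blast
  have eq: "polylog k z = f z" if "z \<in> slit_plane" for z
    by (rule polylog_unique[OF f s that])
  show ?A using f by (rule holomorphic_transform) (rule eq[symmetric])
  assume u: "u \<in> ball 0 1"
  then have "polylog k u = f u" using ball_subset_slit_plane by (intro eq) blast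
  then show "(\<lambda>n. u ^ Suc n / of_nat (Suc n) ^ k) sums polylog k u"
    using bspec[OF s u] by (simp only:)
qed

lemma has_field_derivative_polylog:
  assumes "z \<in> slit_plane" "z \<noteq> 0"
  shows "(polylog (Suc k) has_field_derivative polylog k z / z) (at z)"
proof -
  have "\<forall>u\<in>ball 0 1. (\<lambda>n. u ^ Suc n / of_nat (Suc n) ^ k) sums polylog k u"
    by (intro ballI polylog_sums)
  from polylog_primitive[OF polylog_holomorphic this]
  obtain G where G: "G holomorphic_on slit_plane"
      "\<forall>u\<in>ball 0 1. (\<lambda>n. u ^ Suc n / of_nat (Suc n) ^ Suc k) sums G u"
    and dG: "\<forall>z\<in>slit_plane - {0}. (G has_field_derivative polylog k z / z) (at z)"
    by (elim exE conjE)
  have "(G has_field_derivative polylog k z / z) (at z)" using dG assms by simp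
  then show ?thesis
    by (rule has_field_derivative_transform_within_open[OF _ open_slit_plane assms(1)])
       (rule polylog_unique[OF G, symmetric])
qed

lemma isCont_polylog: "z \<in> slit_plane \<Longrightarrow> isCont (polylog k) z"
  using holomorphic_on_imp_continuous_on[OF polylog_holomorphic]
    continuous_on_eq_continuous_at[OF open_slit_plane] by blast

lemma polylog_zero [simp]: "polylog k 0 = 0"
proof -
  have "(\<lambda>n. 0) sums polylog k 0" using polylog_sums[of 0 k] by simp
  then show ?thesis using sums_unique2 sums_zero by blast
qed

lemma polylog_1_right: "polylog k 1 = zeta_nat k"
  by (simp add: polylog_def)

lemma polylog_0:
  assumes "z \<in> slit_plane" shows "polylog 0 z = z / (1 - z)"
  by (rule polylog_unique[OF polylog_0_series assms])

text \<open>Both sides have derivative 1/(1 - z) away from 0, are continuous at 0 and vanish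
  there.\<close>

lemma polylog_1:
  assumes "z \<in> slit_plane" shows "polylog (Suc 0) z = - Ln (1 - z)"
proof -
  have ln: "1 - x \<notin> \<real>\<^sub>\<le>\<^sub>0" if "x \<in> slit_plane" for x
    using that by (auto simp add: mem_slit_plane complex_nonpos_Reals_iff)
  have cont: "continuous_on slit_plane (\<lambda>z. polylog (Suc 0) z + Ln (1 - z))"
    using ln holomorphic_on_imp_continuous_on[OF polylog_holomorphic]
    by (intro continuous_on_add continuous_on_Ln' continuous_on_diff continuous_on_const
        continuous_on_id) auto
  obtain d where d: "\<And>z. z \<in> slit_plane \<Longrightarrow> polylog (Suc 0) z + Ln (1 - z) = d"
  proof (rule DERIV_zero_connected_constant[of slit_plane "{0}" "\<lambda>z. polylog (Suc 0) z + Ln (1 - z)"])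
    show "\<forall>x\<in>slit_plane - {0}. DERIV (\<lambda>z. polylog (Suc 0) z + Ln (1 - z)) x :> 0"
    proof
      fix x assume x: "x \<in> slit_plane - {0}"
      then have "DERIV (polylog (Suc 0)) x :> 1 / (1 - x)"
        using has_field_derivative_polylog[of x 0] by (simp add: polylog_0)
      moreover have "DERIV (\<lambda>z. Ln (1 - z)) x :> - 1 / (1 - x)"
        using x ln[of x] by (auto intro!: derivative_eq_intros simp: inverse_eq_divide)
      ultimately show "DERIV (\<lambda>z. polylog (Suc 0) z + Ln (1 - z)) x :> 0"
        by (rule DERIV_add[THEN DERIV_cong]) simp
    qed
  qed (use cont open_slit_plane starlike_imp_connected[OF starlike_slit_plane] in auto)
  have "d = 0" using d[of 0] zero_in_slit_plane by simp
  then show ?thesis using d[OF assms] by (simp add: eq_neg_iff_add_eq_0)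
qed


section \<open>Derivative rules, boundary value at 1, duplication\<close>

lemma has_field_derivative_polylog' [derivative_intros]:
  assumes "(f has_field_derivative f') (at z within S)" "f z \<in> slit_plane" "f z \<noteq> 0"
  shows "((\<lambda>z. polylog (Suc k) (f z)) has_field_derivative polylog k (f z) / f z * f') (at z within S)"
  using DERIV_chain[OF has_field_derivative_polylog[OF assms(2,3)] assms(1)]
  by (simp add: o_def)

text \<open>The rule for the numeral 2, with Li_1 already rewritten as a logarithm; from here on
  only weights 2 and 3 are differentiated.\<close>

lemma has_field_derivative_polylog_2 [derivative_intros]:
  assumes "(f has_field_derivative f') (at z within S)" "f z \<in> slit_plane" "f z \<noteq> 0"
  shows "((\<lambda>z. polylog 2 (f z)) has_field_derivative - Ln (1 - f z) / f z * f') (at z within S)"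
  using has_field_derivative_polylog'[OF assms, of "Suc 0"] assms(2)
  by (simp add: polylog_1 numeral_2_eq_2)

lemma has_field_derivative_polylog_3 [derivative_intros]:
  assumes "(f has_field_derivative f') (at z within S)" "f z \<in> slit_plane" "f z \<noteq> 0"
  shows "((\<lambda>z. polylog 3 (f z)) has_field_derivative polylog 2 (f z) / f z * f') (at z within S)"
  using has_field_derivative_polylog'[OF assms, of 2] by (simp add: numeral_3_eq_3 numeral_2_eq_2)

text \<open>The point 1 lies on the slit, so holomorphy says nothing there. For
  \<open>k >= 2\<close> the series is dominated by the convergent sum of 1/n^k, and the uniform
  limit is continuous up to 1. This later fixes the constants of integration as zeta values.\<close>

lemma continuous_on_polylog_insert_1:
  assumes "k \<ge> 2"
  shows "continuous_on (insert 1 (ball 0 1)) (polylog k)"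
proof -
  define f :: "nat \<Rightarrow> complex \<Rightarrow> complex" where "f n z = z ^ Suc n / of_nat (Suc n) ^ k" for n z
  have "uniform_limit (insert 1 (ball 0 1)) (\<lambda>n z. \<Sum>i<n. f i z) (\<lambda>z. \<Sum>i. f i z) sequentially"
  proof (rule Weierstrass_m_test)
    show "summable (\<lambda>n. inverse (real (Suc n) ^ k))"
      using inverse_power_summable[OF assms, where 'a = real] by (subst summable_Suc_iff)
    fix n :: nat and z :: complex assume "z \<in> insert 1 (ball 0 1)"
    then have "norm z \<le> 1" by auto
    then show "norm (f n z) \<le> inverse (real (Suc n) ^ k)"
      by (simp add: f_def norm_divide norm_mult norm_power divide_simps power_le_one mult_le_one
          del: of_nat_Suc)
  qed
  then have "continuous_on (insert 1 (ball 0 1)) (\<lambda>z. \<Sum>i. f i z)"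
    by (rule uniform_limit_theorem[rotated])
       (auto intro!: continuous_intros always_eventually simp: f_def simp del: of_nat_Suc)
  moreover have "(\<Sum>i. f i z) = polylog k z" if "z \<in> insert 1 (ball 0 1)" for z
  proof (cases "z = 1")
    case True
    then show ?thesis by (simp add: f_def polylog_1_right zeta_nat_def)
  next
    case False
    then show ?thesis using that polylog_sums[of z k]
      unfolding f_def[abs_def] by (intro sums_unique[symmetric]) auto
  qed
  ultimately show ?thesis by (rule continuous_on_eq)
qed

lemma zeta_nat_2: "zeta_nat 2 = of_real (pi\<^sup>2 / 6)"
proof -
  have "(\<lambda>n. complex_of_real (1 / real ((n + 1)\<^sup>2))) sums of_real (pi\<^sup>2 / 6)"
    using inverse_squares_sums by (rule sums_of_real)
  then have "(\<lambda>n. 1 / of_nat (Suc n) ^ 2) sums complex_of_real (pi\<^sup>2 / 6)"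
    by simp
  then show ?thesis unfolding zeta_nat_def by (rule sums_unique[symmetric])
qed

text \<open>In the sum of the two series the odd powers of z cancel and the even ones
  double.\<close>

lemma polylog_duplication:
  assumes "z \<in> ball 0 1"
  shows "polylog k z + polylog k (- z) = 2 / 2 ^ k * polylog k (z\<^sup>2)"
proof -
  have z2: "z\<^sup>2 \<in> ball 0 1"
    using assms by (simp add: norm_power power_less_one_iff abs_square_less_1)
  define f where "f n = z ^ Suc n / of_nat (Suc n) ^ k + (- z) ^ Suc n / of_nat (Suc n) ^ k" for n
  have "f sums (polylog k z + polylog k (- z))"
    unfolding f_def[abs_def] using assms by (intro sums_add polylog_sums) auto
  \<comment> \<open>Index \<open>n\<close> carries the exponent \<open>Suc n\<close>, so the
    surviving even exponents sit at the odd indices.\<close>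
  then have "(\<lambda>m. f (2 * m + 1)) sums (polylog k z + polylog k (- z))"
  proof (subst sums_mono_reindex)
    show "strict_mono (\<lambda>m::nat. 2 * m + 1)" by (simp add: strict_mono_def)
    fix n :: nat assume n: "n \<notin> range (\<lambda>m. 2 * m + 1)"
    have "even n"
    proof (rule ccontr)
      assume "odd n"
      then obtain m where "n = 2 * m + 1" by (rule oddE)
      then show False using n by blast
    qed
    then show "f n = 0" by (simp add: f_def)
  qed
  moreover have "f (2 * m + 1) = 2 / 2 ^ k * ((z\<^sup>2) ^ Suc m / of_nat (Suc m) ^ k)" for m
  proof -
    have "of_nat (Suc (2 * m + 1)) ^ k = (2 ^ k * of_nat (Suc m) ^ k :: complex)"
      by (simp flip: power_mult_distrib)
    moreover have "(- z) ^ Suc (2 * m + 1) = (z\<^sup>2) ^ Suc m" "z ^ Suc (2 * m + 1) = (z\<^sup>2) ^ Suc m"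
      by (simp_all add: power_mult power2_eq_square flip: power_mult_distrib)
    ultimately show ?thesis unfolding f_def by simp
  qed
  ultimately have "(\<lambda>m. 2 / 2 ^ k * ((z\<^sup>2) ^ Suc m / of_nat (Suc m) ^ k)) sums
      (polylog k z + polylog k (- z))" by (simp only:)
  moreover have "(\<lambda>m. 2 / 2 ^ k * ((z\<^sup>2) ^ Suc m / of_nat (Suc m) ^ k)) sums
      (2 / 2 ^ k * polylog k (z\<^sup>2))"
    by (intro sums_mult polylog_sums z2)
  ultimately show ?thesis by (rule sums_unique2)
qed

section \<open>Functional equations of the dilogarithm and trilogarithm\<close>

definition slit_disc :: "complex set" where
  "slit_disc = ball 0 1 - complex_of_real ` {-1<..0}"

lemma mem_slit_disc: "z \<in> slit_disc \<longleftrightarrow> norm z < 1 \<and> (Im z = 0 \<longrightarrow> Re z > 0)"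
proof -
  have "z \<in> complex_of_real ` {-1<..0} \<longleftrightarrow> Im z = 0 \<and> Re z \<le> 0 \<and> Re z > -1"
    by (auto simp: complex_eq_iff image_iff)
  moreover have "Re z > -1" if "norm z < 1" using that abs_Re_le_cmod[of z] by linarith
  ultimately show ?thesis by (auto simp: slit_disc_def)
qed

lemma slit_disc_eq: "slit_disc = ball 0 1 - \<real>\<^sub>\<le>\<^sub>0"
  by (auto simp: mem_slit_disc complex_nonpos_Reals_iff set_eq_iff)

lemma open_slit_disc: "open slit_disc"
  by (simp add: slit_disc_eq open_Diff)

text \<open>The origin is on the slit, so the star centre is taken to be 1/2: a segment from 1/2
  meets the real axis only in positive points, unless it ends there.\<close>

lemma connected_slit_disc: "connected slit_disc"
proof -
  have "closed_segment (1/2) z \<subseteq> slit_disc" if z: "z \<in> slit_disc" for z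
  proof
    fix w assume w: "w \<in> closed_segment (1/2) z"
    have "closed_segment (1/2) z \<subseteq> ball 0 1"
      using z by (intro closed_segment_subset) (auto simp: mem_slit_disc)
    then have "norm w < 1" using w by auto
    moreover obtain u where u: "0 \<le> u" "u \<le> 1" "w = of_real (1 - u) * (1/2) + of_real u * z"
      using w by (auto simp: in_segment scaleR_conv_of_real)
    have "Re w > 0" if "Im w = 0"
    proof -
      have "u = 0 \<or> Re z > 0" using that u z by (auto simp: mem_slit_disc)
      then show ?thesis using u
        by (cases "u = 0") (auto intro!: add_nonneg_pos simp: complex_eq_iff)
    qed
    ultimately show "w \<in> slit_disc" by (simp add: mem_slit_disc)
  qed
  moreover have "1/2 \<in> slit_disc" by (simp add: mem_slit_disc)
  ultimately show ?thesis by (intro starlike_imp_connected) (auto simp: starlike_def)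
qed

lemma slit_disc_subset:
  assumes "z \<in> slit_disc"
  shows "z \<in> ball 0 1" "z \<in> slit_plane" "- z \<in> slit_plane" "1 - z \<in> slit_plane"
    "z \<notin> \<real>\<^sub>\<le>\<^sub>0" "1 - z \<notin> \<real>\<^sub>\<le>\<^sub>0" "1 + z \<notin> \<real>\<^sub>\<le>\<^sub>0" "z \<noteq> 0" "z \<noteq> 1" "z \<noteq> -1"
  using assms abs_Re_le_cmod[of z]
  by (auto simp: mem_slit_disc mem_slit_plane complex_nonpos_Reals_iff)

text \<open>The common scheme for the identities on the slit disc. The value of the constant is read
  off as a limit along the real interval (0,1), the filter being 0+ or 1-, since no convenient
  interior point is available.\<close>

lemma constant_on_slit_disc:
  assumes "\<And>z. z \<in> slit_disc \<Longrightarrow> (f has_field_derivative 0) (at z)"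
    and lim: "((\<lambda>x. f (of_real x)) \<longlongrightarrow> c) F" "F \<noteq> bot" "eventually (\<lambda>x. 0 < x \<and> x < 1) F"
    and z: "z \<in> slit_disc"
  shows "f z = c"
proof -
  have "continuous_on slit_disc f"
    using assms(1) by (intro continuous_at_imp_continuous_on ballI) (blast intro: DERIV_isCont)
  then obtain d where d: "\<And>z. z \<in> slit_disc \<Longrightarrow> f z = d"
    using DERIV_zero_connected_constant[OF connected_slit_disc open_slit_disc finite.emptyI, of f]
      assms(1) by auto
  have "eventually (\<lambda>x. f (of_real x) = d) F"
    using lim(3) by eventually_elim (auto intro!: d simp: mem_slit_disc)
  then have "((\<lambda>x. f (of_real x)) \<longlongrightarrow> d) F" by (rule tendsto_eventually)
  then show ?thesis using lim tendsto_unique d z by metis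
qed

lemma eventually_at_right_0_unit: "eventually (\<lambda>x::real. 0 < x \<and> x < 1) (at_right 0)"
  and eventually_at_left_1_unit: "eventually (\<lambda>x::real. 0 < x \<and> x < 1) (at_left 1)"
  using eventually_at_right_real[of 0 1] eventually_at_left_real[of 0 1] by auto

lemma tendsto_polylog_at_1:
  assumes "k \<ge> 2" "(g \<longlongrightarrow> 1) F" "eventually (\<lambda>x. 0 < g x \<and> g x < 1) F"
  shows "((\<lambda>x::real. polylog k (of_real (g x))) \<longlongrightarrow> zeta_nat k) F"
proof -
  have "continuous (at 1 within insert 1 (ball 0 1)) (polylog k)"
    using continuous_on_polylog_insert_1[OF assms(1)] by (simp add: continuous_on_eq_continuous_within)
  then have "(polylog k \<longlongrightarrow> zeta_nat k) (at 1 within insert 1 (ball 0 1))"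
    by (simp add: continuous_within polylog_1_right)
  moreover have "filterlim (\<lambda>x. complex_of_real (g x)) (at 1 within insert 1 (ball 0 1)) F"
    unfolding filterlim_at
  proof
    show "eventually (\<lambda>x. complex_of_real (g x) \<in> insert 1 (ball 0 1) \<and> complex_of_real (g x) \<noteq> 1) F"
      using assms(3) by eventually_elim auto
    show "((\<lambda>x. complex_of_real (g x)) \<longlongrightarrow> 1) F"
      using tendsto_of_real[OF assms(2)] by simp
  qed
  ultimately show ?thesis by (rule filterlim_compose)
qed

lemma tendsto_polylog_at_0:
  "(g \<longlongrightarrow> 0) F \<Longrightarrow> ((\<lambda>x. polylog k (g x)) \<longlongrightarrow> 0) F"
  using isCont_tendsto_compose[OF isCont_polylog[OF zero_in_slit_plane]] by fastforce

text \<open>The derivatives Ln z/(1 - z) and -Ln(1 - z)/z of the two dilogarithms cancel against the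
  product rule for Ln z Ln(1 - z). As z tends to 0+ only Li_2(1) = zeta(2) remains.\<close>

lemma dilog_reflection:
  assumes "z \<in> slit_disc"
  shows "polylog 2 (1 - z) = of_real pi ^ 2 / 6 - polylog 2 z - Ln z * Ln (1 - z)"
proof -
  define f where "f z = polylog 2 (1 - z) + polylog 2 z + Ln z * Ln (1 - z)" for z
  have "f z = zeta_nat 2"
  proof (rule constant_on_slit_disc[OF _ _ _ eventually_at_right_0_unit assms])
    fix z assume "z \<in> slit_disc"
    note z = slit_disc_subset[OF this]
    then have nz: "1 - z \<noteq> 0" by simp
    show "(f has_field_derivative 0) (at z)"
      unfolding f_def using z nz
      by (auto intro!: derivative_eq_intros) (simp add: divide_simps)
  next
    have "((\<lambda>x::real. ln x * ln (1 - x)) \<longlongrightarrow> 0) (at_right 0)" by real_asymp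
    from tendsto_of_real[OF this]
    have "((\<lambda>x. complex_of_real (ln x * ln (1 - x))) \<longlongrightarrow> 0) (at_right 0)" by simp
    moreover have "((\<lambda>x. polylog 2 (of_real (1 - x))) \<longlongrightarrow> zeta_nat 2) (at_right 0)"
    proof (rule tendsto_polylog_at_1)
      show "((\<lambda>x::real. 1 - x) \<longlongrightarrow> 1) (at_right 0)" by real_asymp
      show "\<forall>\<^sub>F x in at_right 0. 0 < 1 - x \<and> 1 - x < (1::real)"
        using eventually_at_right_0_unit by eventually_elim auto
    qed simp
    moreover have "((\<lambda>x. polylog 2 (complex_of_real x)) \<longlongrightarrow> 0) (at_right 0)"
      by (rule tendsto_polylog_at_0) (auto intro!: tendsto_eq_intros)
    ultimately have "((\<lambda>x. polylog 2 (of_real (1 - x)) + polylog 2 (of_real x)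
        + complex_of_real (ln x * ln (1 - x))) \<longlongrightarrow> zeta_nat 2 + 0 + 0) (at_right 0)"
      by (intro tendsto_add)
    moreover have "\<forall>\<^sub>F x in at_right 0. polylog 2 (of_real (1 - x)) + polylog 2 (of_real x)
        + complex_of_real (ln x * ln (1 - x)) = f (of_real x)"
      using eventually_at_right_0_unit
    proof eventually_elim
      case (elim x)
      then show ?case using Ln_of_real[of x] Ln_of_real[of "1 - x"] by (simp add: f_def)
    qed
    ultimately show "((\<lambda>x. f (of_real x)) \<longlongrightarrow> zeta_nat 2) (at_right 0)"
      by (simp add: filterlim_cong)
  qed simp
  then show ?thesis by (simp add: f_def zeta_nat_2 algebra_simps)
qed

text \<open>In the coordinate 1 - z the map z/(z - 1) is inversion, which preserves the complement
  of the nonpositive reals.\<close>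

lemma slit_plane_moebius:
  assumes "z \<in> slit_plane" shows "z / (z - 1) \<in> slit_plane"
proof -
  have "z \<noteq> 1" using assms by (auto simp: mem_slit_plane)
  then have eq: "z / (z - 1) = 1 - inverse (1 - z)" by (simp add: field_simps)
  have "1 - z \<notin> \<real>\<^sub>\<le>\<^sub>0" using assms by (auto simp: mem_slit_plane complex_nonpos_Reals_iff)
  then have "inverse (1 - z) \<notin> \<real>\<^sub>\<le>\<^sub>0" by simp
  then show ?thesis unfolding eq by (auto simp: mem_slit_plane complex_nonpos_Reals_iff)
qed

text \<open>Because 1 - z/(z - 1) = 1/(1 - z), the logarithm in the derivative of the left side is
  -Ln(1 - z), and everything cancels; all terms vanish at 0.\<close>

lemma dilog_landen:
  assumes "z \<in> slit_plane"
  shows "polylog 2 (z / (z - 1)) = - polylog 2 z - Ln (1 - z) ^ 2 / 2"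
proof -
  define f where "f z = polylog 2 (z / (z - 1)) + polylog 2 z + Ln (1 - z) ^ 2 / 2" for z
  have ln: "1 - x \<notin> \<real>\<^sub>\<le>\<^sub>0" "x \<noteq> 1" if "x \<in> slit_plane" for x
    using that by (auto simp: mem_slit_plane complex_nonpos_Reals_iff)
  have "isCont f x" if "x \<in> slit_plane" for x
  proof -
    have "isCont (\<lambda>z. polylog 2 (z / (z - 1))) x"
      using that ln by (intro isCont_o2[OF _ isCont_polylog] slit_plane_moebius continuous_intros) auto
    moreover have "isCont (\<lambda>z. Ln (1 - z)) x"
      using that ln by (intro isCont_o2[OF _ continuous_at_Ln] continuous_intros) auto
    ultimately show ?thesis unfolding f_def using isCont_polylog[OF that]
      by (intro isCont_add isCont_divide isCont_power continuous_const) auto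
  qed
  then have cont: "continuous_on slit_plane f" by (simp add: continuous_at_imp_continuous_on)
  obtain d where d: "\<And>z. z \<in> slit_plane \<Longrightarrow> f z = d"
  proof (rule DERIV_zero_connected_constant[of slit_plane "{0}" f])
    show "\<forall>x\<in>slit_plane - {0}. DERIV f x :> 0"
    proof
      fix x assume x: "x \<in> slit_plane - {0}"
      then have nz: "x \<noteq> 0" "x \<noteq> 1" "1 - x \<noteq> 0" "x - 1 \<noteq> 0" using ln by auto
      have "1 - x / (x - 1) = inverse (1 - x)" using nz by (simp add: field_simps)
      then have "Ln (1 - x / (x - 1)) = - Ln (1 - x)" using Ln_inverse ln x by simp
      then show "DERIV f x :> 0"
        unfolding f_def using x nz ln slit_plane_moebius[of x]
        by (auto intro!: derivative_eq_intros) (simp add: divide_simps; simp add: algebra_simps)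
    qed
  qed (use cont open_slit_plane starlike_imp_connected[OF starlike_slit_plane] in auto)
  have "d = 0" using d[of 0] zero_in_slit_plane by (simp add: f_def)
  then show ?thesis using d[OF assms] by (simp add: f_def algebra_simps eq_neg_iff_add_eq_0)
qed

text \<open>Differentiation lowers the weight: reflection and Landen's formula for Li_2 reduce the
  derivative to Li_2(z) and logarithms, which cancel. As z tends to 1- only Li_3(1) = zeta(3)
  survives. The identity serves the special value at the inverse golden ratio.\<close>

lemma trilog_landen:
  assumes "z \<in> slit_disc"
  shows "polylog 3 z + polylog 3 (1 - z) + polylog 3 (1 - 1 / z) =
    zeta_nat 3 + Ln z ^ 3 / 6 + of_real pi ^ 2 / 6 * Ln z - Ln z ^ 2 * Ln (1 - z) / 2"
proof -
  define f where "f z = polylog 3 z + polylog 3 (1 - z) + polylog 3 (1 - 1 / z)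
    - Ln z ^ 3 / 6 - of_real pi ^ 2 / 6 * Ln z + Ln z ^ 2 * Ln (1 - z) / 2" for z
  have "f z = zeta_nat 3"
  proof (rule constant_on_slit_disc[OF _ _ _ eventually_at_left_1_unit assms])
    fix z assume zs: "z \<in> slit_disc"
    note z = slit_disc_subset[OF zs]
    then have nz: "1 - z \<noteq> 0" "1 - 1 / z \<noteq> 0" by (auto simp: field_simps)
    \<comment> \<open>Landen's formula is used at \<open>1 - z\<close>, whose Moebius image is
      \<open>1 - 1 / z\<close>.\<close>
    have eq: "(1 - z) / ((1 - z) - 1) = 1 - 1 / z" using z by (simp add: field_simps)
    have sp: "1 - 1 / z \<in> slit_plane" using slit_plane_moebius[OF z(4)] by (simp only: eq)
    have "polylog 2 (1 - 1 / z) = - polylog 2 (1 - z) - Ln z ^ 2 / 2"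
      using dilog_landen[OF z(4)] by (simp only: eq diff_diff_eq2 add_diff_cancel_left')
    then have eq2: "polylog 2 (1 - 1 / z) = - (of_real pi ^ 2 / 6 - polylog 2 z - Ln z * Ln (1 - z)) - Ln z ^ 2 / 2"
      by (simp add: dilog_reflection[OF zs])
    \<comment> \<open>Partial fractions leave only the inverses of z and 1 - z, so that the final
      cancellation is a polynomial identity in these, the logarithms and Li_2(z).\<close>
    have ab: "1 / (1 - 1 / z) * (1 / z ^ 2) = - (inverse z + inverse (1 - z))"
      using z nz by (simp add: field_simps power2_eq_square)
    have d1: "(polylog 3 has_field_derivative polylog 2 z * inverse z) (at z)"
      using z by (auto intro!: derivative_eq_intros simp: divide_inverse)
    have d2: "((\<lambda>z. polylog 3 (1 - z)) has_field_derivative - polylog 2 (1 - z) * inverse (1 - z)) (at z)"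
      using z nz by (auto intro!: derivative_eq_intros simp: divide_inverse)
    have "((\<lambda>z. polylog 3 (1 - 1 / z)) has_field_derivative
        polylog 2 (1 - 1 / z) / (1 - 1 / z) * (1 / z ^ 2)) (at z)"
      using z nz sp by (intro has_field_derivative_polylog_3)
        (auto intro!: derivative_eq_intros simp: power2_eq_square)
    moreover have "polylog 2 (1 - 1 / z) / (1 - 1 / z) * (1 / z ^ 2) =
        - polylog 2 (1 - 1 / z) * (inverse z + inverse (1 - z))"
      using ab by (metis (no_types, lifting) mult.assoc mult_minus_left mult_minus_right
          times_divide_eq_right mult.right_neutral)
    ultimately have d3: "((\<lambda>z. polylog 3 (1 - 1 / z)) has_field_derivative
        - polylog 2 (1 - 1 / z) * (inverse z + inverse (1 - z))) (at z)" by simp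
    have d4: "(Ln has_field_derivative inverse z) (at z)"
      using z by (auto intro!: derivative_eq_intros)
    have d5: "((\<lambda>z. Ln (1 - z)) has_field_derivative - inverse (1 - z)) (at z)"
      using z by (auto intro!: derivative_eq_intros simp: divide_inverse)
    show "(f has_field_derivative 0) (at z)"
      unfolding f_def
      apply (rule DERIV_cong)
       apply (rule d1 d2 d3 d4 d5 DERIV_add DERIV_diff DERIV_cdivide DERIV_cmult DERIV_mult DERIV_power)+
      apply (simp add: eq2 dilog_reflection[OF zs])
      apply (simp add: algebra_simps power2_eq_square add_divide_distrib diff_divide_distrib)
      done
  next
    have "((\<lambda>x::real. - (ln x ^ 3 / 6) - pi ^ 2 / 6 * ln x + ln x ^ 2 * ln (1 - x) / 2) \<longlongrightarrow> 0) (at_left 1)"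
      by real_asymp
    then have "((\<lambda>x. complex_of_real (- (ln x ^ 3 / 6) - pi ^ 2 / 6 * ln x + ln x ^ 2 * ln (1 - x) / 2))
        \<longlongrightarrow> of_real 0) (at_left 1)"
      by (rule tendsto_of_real)
    moreover have "((\<lambda>x. polylog 3 (of_real x)) \<longlongrightarrow> zeta_nat 3) (at_left 1)"
      by (rule tendsto_polylog_at_1) (use eventually_at_left_1_unit in auto)
    moreover have "((\<lambda>x. polylog 3 (1 - complex_of_real x)) \<longlongrightarrow> 0) (at_left 1)"
      by (rule tendsto_polylog_at_0) (auto intro!: tendsto_eq_intros)
    moreover have "((\<lambda>x. polylog 3 (1 - 1 / complex_of_real x)) \<longlongrightarrow> 0) (at_left 1)"
      by (rule tendsto_polylog_at_0) (auto intro!: tendsto_eq_intros)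
    ultimately have "((\<lambda>x. polylog 3 (of_real x) + polylog 3 (1 - complex_of_real x)
        + polylog 3 (1 - 1 / complex_of_real x)
        + complex_of_real (- (ln x ^ 3 / 6) - pi ^ 2 / 6 * ln x + ln x ^ 2 * ln (1 - x) / 2))
        \<longlongrightarrow> zeta_nat 3 + 0 + 0 + of_real 0) (at_left 1)"
      by (intro tendsto_add)
    moreover have "\<forall>\<^sub>F x in at_left 1. polylog 3 (of_real x) + polylog 3 (1 - complex_of_real x)
        + polylog 3 (1 - 1 / complex_of_real x)
        + complex_of_real (- (ln x ^ 3 / 6) - pi ^ 2 / 6 * ln x + ln x ^ 2 * ln (1 - x) / 2) = f (of_real x)"
      using eventually_at_left_1_unit
    proof eventually_elim
      case (elim x)
      then show ?case using Ln_of_real[of x] Ln_of_real[of "1 - x"] by (simp add: f_def)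
    qed
    ultimately show "((\<lambda>x. f (of_real x)) \<longlongrightarrow> zeta_nat 3) (at_left 1)"
      by (simp add: filterlim_cong)
  qed simp
  then show ?thesis by (simp add: f_def algebra_simps)
qed


section \<open>The arctangent integrals\<close>

definition arctan_domain :: "complex set" where
  "arctan_domain = - {\<i> * of_real t | t :: real. \<bar>t\<bar> \<ge> 1}"

lemma mem_arctan_domain: "z \<in> arctan_domain \<longleftrightarrow> (Re z = 0 \<longrightarrow> \<bar>Im z\<bar> < 1)"
proof -
  have "z \<in> {\<i> * of_real t | t :: real. \<bar>t\<bar> \<ge> 1} \<longleftrightarrow> Re z = 0 \<and> \<bar>Im z\<bar> \<ge> 1"
    by (auto simp: complex_eq_iff)
  then show ?thesis by (auto simp: arctan_domain_def)
qed

text \<open>If 1 + z^2 is real then z is real or imaginary, and a real z makes it positive. Hence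
  the cuts of arctan are also the cuts of the principal square root of 1 + z^2.\<close>

lemma arctan_domain_iff: "z \<in> arctan_domain \<longleftrightarrow> 1 + z\<^sup>2 \<notin> \<real>\<^sub>\<le>\<^sub>0"
proof -
  have "1 + z\<^sup>2 \<in> \<real>\<^sub>\<le>\<^sub>0 \<longleftrightarrow> Re z * Im z = 0 \<and> 1 + (Re z)\<^sup>2 \<le> (Im z)\<^sup>2"
    by (auto simp: complex_nonpos_Reals_iff power2_eq_square)
  also have "\<dots> \<longleftrightarrow> Re z = 0 \<and> \<bar>Im z\<bar> \<ge> 1"
  proof
    assume *: "Re z * Im z = 0 \<and> 1 + (Re z)\<^sup>2 \<le> (Im z)\<^sup>2"
    moreover have "Im z \<noteq> 0"
    proof
      assume "Im z = 0"
      then have "1 + (Re z)\<^sup>2 \<le> 0" using * by simp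
      then show False using zero_le_power2[of "Re z"] by linarith
    qed
    ultimately have "Re z = 0" by simp
    then show "Re z = 0 \<and> \<bar>Im z\<bar> \<ge> 1"
      using * abs_le_square_iff[of 1 "Im z"] by simp
  next
    assume "Re z = 0 \<and> \<bar>Im z\<bar> \<ge> 1"
    then show "Re z * Im z = 0 \<and> 1 + (Re z)\<^sup>2 \<le> (Im z)\<^sup>2"
      using abs_le_square_iff[of 1 "Im z"] by simp
  qed
  finally show ?thesis by (auto simp: mem_arctan_domain)
qed

lemma open_arctan_domain: "open arctan_domain"
proof -
  have "arctan_domain = (\<lambda>z. 1 + z\<^sup>2) -` (- \<real>\<^sub>\<le>\<^sub>0)"
    by (auto simp: arctan_domain_iff)
  moreover have "open ((\<lambda>z::complex. 1 + z\<^sup>2) -` (- \<real>\<^sub>\<le>\<^sub>0))"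
    by (intro open_vimage continuous_intros) (simp add: open_Compl)
  ultimately show ?thesis by simp
qed

lemma arctan_domain_scale:
  assumes "v \<in> arctan_domain" "\<bar>t\<bar> \<le> 1" shows "v * of_real t \<in> arctan_domain"
proof -
  have "\<bar>Im v * t\<bar> < 1" if "Re v * t = 0"
  proof (cases "t = 0")
    case False
    then have "\<bar>Im v\<bar> < 1" using that assms by (simp add: mem_arctan_domain)
    moreover have "\<bar>Im v * t\<bar> \<le> \<bar>Im v\<bar>"
      using assms(2) by (simp add: abs_mult mult_left_le)
    ultimately show ?thesis by linarith
  qed simp
  then show ?thesis by (simp add: mem_arctan_domain)
qed

lemma arctan_domain_nonzero: "z \<in> arctan_domain \<Longrightarrow> 1 + z\<^sup>2 \<noteq> 0"
  by (auto simp: arctan_domain_iff)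

lemma has_field_derivative_Arctan':
  assumes "(f has_field_derivative f') (at z within S)" "f z \<in> arctan_domain"
  shows "((\<lambda>z. Arctan (f z)) has_field_derivative f' / (1 + (f z)\<^sup>2)) (at z within S)"
  using DERIV_chain[OF has_field_derivative_Arctan[of "f z"] assms(1)] assms(2)
  by (simp add: o_def mem_arctan_domain divide_inverse mult.commute)

text \<open>With the value 1 at 0, \<open>v * arctan_quot (v * of_real t)\<close> extends
  arctan(vt)/t continuously to t = 0, and is differentiable in v there as well.\<close>

definition arctan_quot :: "complex \<Rightarrow> complex" where
  "arctan_quot u = (if u = 0 then 1 else Arctan u / u)"

lemma arctan_quot_holomorphic: "arctan_quot holomorphic_on arctan_domain"
proof -
  have deriv: "deriv Arctan 0 = 1"
    using has_field_derivative_Arctan[of 0] by (intro DERIV_imp_deriv) simp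
  have "Arctan holomorphic_on arctan_domain"
    by (rule holomorphic_on_Arctan) (auto simp: mem_arctan_domain)
  then have "(\<lambda>z. if z = 0 then deriv Arctan 0 else (Arctan z - Arctan 0) / (z - 0)) holomorphic_on arctan_domain"
    using open_arctan_domain by (rule pole_lemma_open)
  moreover have "(\<lambda>z. if z = 0 then deriv Arctan 0 else (Arctan z - Arctan 0) / (z - 0)) = arctan_quot"
    using deriv by (auto simp: arctan_quot_def fun_eq_iff)
  ultimately show ?thesis by simp
qed

lemma mult_arctan_quot: "v * arctan_quot (v * of_real t) = (if t = 0 then v else Arctan (v * of_real t) / of_real t)"
  by (auto simp: arctan_quot_def)

lemma continuous_on_arctan_quot:
  assumes "v \<in> arctan_domain"
  shows "continuous_on {0..1} (\<lambda>t. v * arctan_quot (v * of_real t))"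
  using arctan_domain_scale[OF assms]
  by (intro continuous_intros continuous_on_compose2[OF
      holomorphic_on_imp_continuous_on[OF arctan_quot_holomorphic]]) auto

text \<open>This is \<open>K(v)\<close> of the overview. Subtracting pi/2, the value of arcsin at 1,
  makes the boundary term at t = 1 vanish in the later integration by parts.\<close>

definition TS_reduced :: "complex \<Rightarrow> complex" where
  "TS_reduced v = integral {0..1}
     (\<lambda>t. of_real (arcsin t - pi / 2) * (v * arctan_quot (v * of_real t)))"

lemma TS_1_right:
  assumes "v \<in> arctan_domain"
  shows "TS v 1 = of_real pi / 2 * contour_integral (linepath 0 v) (\<lambda>u. Arctan u / u) + TS_reduced v"
proof -
  define q where "q t = v * arctan_quot (v * of_real t)" for t
  have cq: "continuous_on {0..1} q"
    unfolding q_def[abs_def] by (rule continuous_on_arctan_quot[OF assms])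
  have as: "continuous_on {0..1} (\<lambda>t. complex_of_real (arcsin t))"
    by (intro continuous_intros) auto
  have i1: "q integrable_on {0..1}" "(\<lambda>t. of_real (arcsin t) * q t) integrable_on {0..1}"
    using cq as by (auto intro!: integrable_continuous_real continuous_intros)
  have "TS v 1 = integral {0..1} (\<lambda>t. of_real (arcsin t) * q t)"
    unfolding TS_def
  \<comment> \<open>At 0 the integrand of \<open>TS\<close> has the value 0, by division by zero,
    while \<open>q 0 = v\<close>; one point does not affect the integral.\<close>
  proof (rule integral_spike[of "{0}"])
    fix x :: real assume "x \<in> {0..1} - {0}"
    then show "of_real (arcsin x) * q x =
        Arctan (v * of_real x) * Arcsin (1 * of_real x) / of_real x"
      using of_real_arcsin[of x] by (simp add: q_def mult_arctan_quot)
  qed simp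
  moreover have "contour_integral (linepath 0 v) (\<lambda>u. Arctan u / u) = integral {0..1} q"
  proof (rule contour_integral_unique)
    have "((\<lambda>x. Arctan (linepath 0 v x) / linepath 0 v x * (v - 0)) has_integral integral {0..1} q) {0..1}"
    proof (rule has_integral_spike_finite[of "{0}" _ _ q])
      fix x :: real assume "x \<in> {0..1} - {0}"
      then show "Arctan (linepath 0 v x) / linepath 0 v x * (v - 0) = q x"
        by (simp add: q_def mult_arctan_quot linepath_def scaleR_conv_of_real mult.commute)
    qed (use i1 in auto)
    then show "((\<lambda>u. Arctan u / u) has_contour_integral integral {0..1} q) (linepath 0 v)"
      by (simp add: has_contour_integral_linepath)
  qed
  moreover have "TS_reduced v = integral {0..1} (\<lambda>t. of_real (arcsin t) * q t)
      - of_real pi / 2 * integral {0..1} q"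
  proof -
    have "TS_reduced v = integral {0..1} (\<lambda>t. of_real (arcsin t) * q t - of_real pi / 2 * q t)"
      unfolding TS_reduced_def q_def by (simp add: algebra_simps)
    also have "\<dots> = integral {0..1} (\<lambda>t. of_real (arcsin t) * q t) - integral {0..1} (\<lambda>t. of_real pi / 2 * q t)"
      using i1 by (intro integral_diff) auto
    finally show ?thesis by simp
  qed
  ultimately show ?thesis by simp
qed

text \<open>The substitution \<open>v = tan 2\<theta>\<close>, \<open>r = tan \<theta>\<close>.\<close>

definition tan_double :: "complex \<Rightarrow> complex" where
  "tan_double r = 2 * r / (1 - r\<^sup>2)"

lemma one_minus_square_nonzero: "norm (r::complex) < 1 \<Longrightarrow> 1 - r\<^sup>2 \<noteq> 0"
  by (metis abs_square_less_1 abs_norm_cancel eq_iff_diff_eq_0 less_irrefl norm_one norm_power)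

text \<open>One has 1 + v^2 = w^2 for the Cayley transform w = (1 + r^2)/(1 - r^2). It maps the disc
  to the right half-plane, and squares from there avoid the nonpositive reals.\<close>

lemma tan_double_in_arctan_domain:
  assumes "norm r < 1" shows "tan_double r \<in> arctan_domain"
proof -
  define w where "w = (1 + r\<^sup>2) / (1 - r\<^sup>2)"
  have nz: "1 - r\<^sup>2 \<noteq> 0" using assms by (rule one_minus_square_nonzero)
  have "(1 + r\<^sup>2)\<^sup>2 = (1 - r\<^sup>2)\<^sup>2 + (2 * r)\<^sup>2"
    by (simp add: power2_eq_square algebra_simps)
  then have "w\<^sup>2 = ((1 - r\<^sup>2)\<^sup>2 + (2 * r)\<^sup>2) / (1 - r\<^sup>2)\<^sup>2"
    by (simp only: w_def power_divide)
  then have "1 + (tan_double r)\<^sup>2 = w\<^sup>2"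
    using nz by (simp add: tan_double_def power_divide add_divide_distrib)
  moreover have "Re w > 0"
  proof -
    have "Re ((1 + q) * cnj (1 - q)) = 1 - norm q ^ 2" for q
      unfolding cmod_power2 by (simp add: algebra_simps power2_eq_square)
    then have "Re ((1 + r\<^sup>2) * cnj (1 - r\<^sup>2)) = 1 - norm (r\<^sup>2) ^ 2" .
    moreover have "norm (r\<^sup>2) ^ 2 < 1"
      using assms by (simp add: norm_power power_less_one_iff flip: power_mult)
    ultimately have "Re ((1 + r\<^sup>2) * cnj (1 - r\<^sup>2)) > 0" by linarith
    moreover have "w = ((1 + r\<^sup>2) * cnj (1 - r\<^sup>2)) / of_real (norm (1 - r\<^sup>2) ^ 2)"
      by (simp only: w_def complex_div_cnj[of "1 + r\<^sup>2"])
    ultimately show ?thesis using nz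
      by (simp only: Re_divide_of_real) (simp add: zero_less_divide_iff)
  qed
  moreover have "w\<^sup>2 \<notin> \<real>\<^sub>\<le>\<^sub>0" if "Re w > 0"
    using that by (auto simp: complex_nonpos_Reals_iff power2_eq_square mult_le_0_iff)
  ultimately show ?thesis by (simp add: arctan_domain_iff)
qed

text \<open>Off the cuts the principal root w of 1 + v^2 has positive real part, and r^2 = (w -
  1)/(w + 1) is its inverse Cayley transform, of modulus below 1.\<close>

lemma tan_double_inverse:
  assumes "v \<in> arctan_domain" and r: "r = v / (1 + csqrt (1 + v\<^sup>2))"
  shows "norm r < 1" "tan_double r = v"
proof -
  define w where "w = csqrt (1 + v\<^sup>2)"
  have w2: "w\<^sup>2 = 1 + v\<^sup>2" by (simp add: w_def)
  have "Re w \<noteq> 0"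
  proof
    assume "Re w = 0"
    then have "w\<^sup>2 \<in> \<real>\<^sub>\<le>\<^sub>0" by (simp add: complex_nonpos_Reals_iff power2_eq_square)
    then show False using assms(1) by (simp add: w2 arctan_domain_iff)
  qed
  then have Rw: "Re w > 0" using Re_csqrt[of "1 + v\<^sup>2"] by (simp add: w_def)
  then have nz: "1 + w \<noteq> 0" by (auto simp: complex_eq_iff)
  have "v\<^sup>2 = (w - 1) * (1 + w)" using w2 by (simp add: algebra_simps power2_eq_square)
  then have r2: "r\<^sup>2 = (w - 1) / (1 + w)"
    using nz unfolding r w_def[symmetric] power_divide by (simp add: power2_eq_square)
  have "norm (w - 1) ^ 2 < norm (1 + w) ^ 2"
    using Rw unfolding cmod_power2 by (simp add: power2_eq_square algebra_simps)
  then have "norm (w - 1) < norm (1 + w)" by (rule power2_less_imp_less) simp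
  then have "norm (r\<^sup>2) < 1" using nz by (simp add: r2 norm_divide)
  then show "norm r < 1" by (simp add: norm_power abs_square_less_1)
  have "1 - r\<^sup>2 = 2 / (1 + w)" using nz by (simp add: r2 field_simps)
  then show "tan_double r = v" using nz by (simp add: tan_double_def r flip: w_def)
qed

lemma has_field_derivative_tan_double:
  assumes "norm r < 1"
  shows "(tan_double has_field_derivative 2 * (1 + r\<^sup>2) / (1 - r\<^sup>2)\<^sup>2) (at r within S)"
  unfolding tan_double_def[abs_def] using one_minus_square_nonzero[OF assms]
  by (auto intro!: derivative_eq_intros simp: field_simps power2_eq_square)

lemma continuous_on_tan_double: "continuous_on (ball 0 1) tan_double"
  using has_field_derivative_tan_double
  by (intro continuous_at_imp_continuous_on ballI) (auto intro: DERIV_isCont)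

section \<open>Differentiation under the integral sign\<close>

definition arctan_sin_integral :: "complex \<Rightarrow> complex" where
  "arctan_sin_integral v = integral {0..pi/2} (\<lambda>s. Arctan (v * of_real (sin s)))"

text \<open>This is \<open>K'(v)\<close>, since arctan(vt)/t has the derivative 1/(1 + (vt)^2) in v;
  \<open>arctan_sin_integral\<close> is \<open>H(v)\<close>.\<close>

definition TS_kernel :: "complex \<Rightarrow> complex" where
  "TS_kernel v = integral {0..1} (\<lambda>t. of_real (arcsin t - pi / 2) / (1 + (v * of_real t)\<^sup>2))"

text \<open>The parameter is r rather than v because the Leibniz rule asks for a convex parameter
  set: the disc is convex, the slit domain of v is not.\<close>

lemma has_field_derivative_TS_reduced:
  assumes r: "norm r < 1"
  shows "((\<lambda>r. TS_reduced (tan_double r)) has_field_derivative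
     2 * (1 + r\<^sup>2) / (1 - r\<^sup>2)\<^sup>2 * TS_kernel (tan_double r)) (at r)"
proof -
  define f where "f r t = of_real (arcsin t - pi / 2) * (tan_double r * arctan_quot (tan_double r * of_real t))" for r t
  define f' where "f' r t = 2 * (1 + r\<^sup>2) / (1 - r\<^sup>2)\<^sup>2 *
      (of_real (arcsin t - pi / 2) / (1 + (tan_double r * of_real t)\<^sup>2))" for r t
  have dom: "tan_double r * of_real t \<in> arctan_domain" if "norm r < 1" "t \<in> {0..1}" for r t
    using that by (intro arctan_domain_scale tan_double_in_arctan_domain) auto
  have "((\<lambda>r. integral (cbox 0 1) (f r)) has_field_derivative integral (cbox 0 1) (f' r)) (at r within ball 0 1)"
  proof (rule leibniz_rule_field_derivative)
    fix x :: complex and t :: real assume x: "x \<in> ball 0 1" and t: "t \<in> cbox 0 1"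
    note td = has_field_derivative_tan_double[of x "ball 0 1"]
    have "((\<lambda>r. tan_double r * arctan_quot (tan_double r * of_real t)) has_field_derivative
        2 * (1 + x\<^sup>2) / (1 - x\<^sup>2)\<^sup>2 / (1 + (tan_double x * of_real t)\<^sup>2)) (at x within ball 0 1)"
    \<comment> \<open>For t = 0 the function of r is \<open>tan_double\<close> itself, otherwise it
      is an arctangent divided by t.\<close>
    proof (cases "t = 0")
      case True
      then show ?thesis using td x by (simp add: arctan_quot_def)
    next
      case False
      have "((\<lambda>r. Arctan (tan_double r * of_real t)) has_field_derivative
          (2 * (1 + x\<^sup>2) / (1 - x\<^sup>2)\<^sup>2 * of_real t) / (1 + (tan_double x * of_real t)\<^sup>2)) (at x within ball 0 1)"
        using td x t dom[of x t]
        by (intro has_field_derivative_Arctan' DERIV_cmult_right) auto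
      from DERIV_cdivide[OF this, of "of_real t"] show ?thesis
        unfolding mult_arctan_quot using False by simp
    qed
    from DERIV_cmult[OF this, of "of_real (arcsin t - pi / 2)"]
    show "((\<lambda>x. f x t) has_field_derivative f' x t) (at x within ball 0 1)"
      by (simp add: f_def f'_def mult_ac)
  next
    fix x :: complex assume "x \<in> ball 0 1"
    then have "continuous_on {0..1} (\<lambda>t. tan_double x * arctan_quot (tan_double x * of_real t))"
      by (intro continuous_on_arctan_quot tan_double_in_arctan_domain) auto
    then show "f x integrable_on cbox 0 1"
      unfolding f_def[abs_def]
      by (auto intro!: integrable_continuous_real continuous_intros)
  next
    have td: "continuous_on (ball 0 1 \<times> {0..1::real}) (\<lambda>p. tan_double (fst p))"
      by (rule continuous_on_compose2[OF continuous_on_tan_double]) (auto intro!: continuous_intros)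
    have "continuous_on (ball 0 1 \<times> {0..1}) (\<lambda>p. f' (fst p) (snd p))"
      unfolding f'_def
      using one_minus_square_nonzero dom arctan_domain_nonzero
      by (intro continuous_intros td) auto
    then show "continuous_on (ball 0 1 \<times> cbox 0 1) (\<lambda>(x, t). f' x t)"
      by (simp add: case_prod_unfold)
  qed (use r in auto)
  then have "((\<lambda>r. integral {0..1} (f r)) has_field_derivative integral {0..1} (f' r)) (at r)"
    using r by (simp add: at_within_open[of r "ball 0 1"])
  moreover have "integral {0..1} (f' r) = 2 * (1 + r\<^sup>2) / (1 - r\<^sup>2)\<^sup>2 * TS_kernel (tan_double r)"
    unfolding f'_def[abs_def] TS_kernel_def by (rule integral_mult_right)
  ultimately show ?thesis
    by (simp only: f_def[abs_def] TS_reduced_def)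
qed

lemma sin_mult_arctan_domain:
  "v \<in> arctan_domain \<Longrightarrow> v * sin (complex_of_real s) \<in> arctan_domain"
  using arctan_domain_scale[of v "sin s"] by (simp add: sin_of_real)

text \<open>Substitute t = sin s and integrate by parts.\<close>

lemma TS_kernel_eq:
  assumes "v \<in> arctan_domain"
  shows "v * TS_kernel v = - arctan_sin_integral v"
proof -
  define \<phi> where "\<phi> t = complex_of_real (arcsin t - pi / 2) / (1 + (v * of_real t)\<^sup>2)" for t
  have dom: "v * of_real t \<in> arctan_domain" if "\<bar>t\<bar> \<le> 1" for t
    using assms that by (rule arctan_domain_scale)
  have "continuous_on {0..1} \<phi>"
    unfolding \<phi>_def using dom arctan_domain_nonzero by (intro continuous_intros) auto
  then have "((\<lambda>s. cos s *\<^sub>R \<phi> (sin s)) has_integral integral {sin 0..sin (pi/2)} \<phi>) {0..pi/2}"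
    by (intro has_integral_substitution[of 0 "pi/2" sin 0 1])
       (auto intro!: derivative_eq_intros sin_ge_zero)
  then have 1: "((\<lambda>s. cos s *\<^sub>R \<phi> (sin s)) has_integral TS_kernel v) {0..pi/2}"
    by (simp add: TS_kernel_def \<phi>_def[abs_def])
  have "continuous_on {0..pi/2} (\<lambda>s. Arctan (v * of_real (sin s)))"
  proof (rule continuous_on_compose2[of arctan_domain Arctan])
    show "continuous_on arctan_domain Arctan"
      by (rule continuous_on_Arctan) (auto simp: mem_arctan_domain)
  qed (use dom in \<open>auto intro!: continuous_intros\<close>)
  then have 2: "((\<lambda>s. Arctan (v * of_real (sin s))) has_integral arctan_sin_integral v) {0..pi/2}"
    unfolding arctan_sin_integral_def by (intro integrable_integral integrable_continuous_real)
  \<comment> \<open>The boundary function vanishes at both ends: at pi/2 through its first factor,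
    at 0 through sin 0 = 0. Its derivative is the sum of the two integrands.\<close>
  define \<Phi> where "\<Phi> s = (s - of_real pi / 2) * Arctan (v * sin s)" for s
  have "((\<lambda>s. Arctan (v * of_real (sin s)) + v * (cos s *\<^sub>R \<phi> (sin s))) has_integral
      \<Phi> (of_real (pi/2)) - \<Phi> (of_real 0)) {0..pi/2}"
  proof (rule fundamental_theorem_of_calculus)
    fix s :: real assume s: "s \<in> {0..pi/2}"
    have "(\<Phi> has_field_derivative
        1 * Arctan (v * sin (of_real s)) + v * cos (of_real s) / (1 + (v * sin (of_real s))\<^sup>2) * (of_real s - of_real pi / 2))
        (at (of_real s))"
      unfolding \<Phi>_def
      by (intro DERIV_mult has_field_derivative_Arctan' sin_mult_arctan_domain[OF assms])
         (auto intro!: derivative_eq_intros)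
    moreover have "1 * Arctan (v * sin (of_real s)) + v * cos (of_real s) / (1 + (v * sin (of_real s))\<^sup>2) * (of_real s - of_real pi / 2)
      = Arctan (v * of_real (sin s)) + v * (cos s *\<^sub>R \<phi> (sin s))"
      using s by (simp add: \<phi>_def arcsin_sin scaleR_conv_of_real sin_of_real cos_of_real)
    ultimately have "(\<Phi> has_field_derivative Arctan (v * of_real (sin s)) + v * (cos s *\<^sub>R \<phi> (sin s))) (at (of_real s))"
      by simp
    then show "((\<lambda>s. \<Phi> (of_real s)) has_vector_derivative
        Arctan (v * of_real (sin s)) + v * (cos s *\<^sub>R \<phi> (sin s))) (at s within {0..pi/2})"
      by (rule has_vector_derivative_real_field)
  qed simp
  moreover have "\<Phi> (of_real (pi/2)) - \<Phi> (of_real 0) = 0"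
    by (simp add: \<Phi>_def)
  moreover have "((\<lambda>s. Arctan (v * of_real (sin s)) + v * (cos s *\<^sub>R \<phi> (sin s))) has_integral
      arctan_sin_integral v + v * TS_kernel v) {0..pi/2}"
    using 1 2 by (intro has_integral_add has_integral_mult_right)
  ultimately have "arctan_sin_integral v + v * TS_kernel v = 0"
    using has_integral_unique by metis
  then show ?thesis by (simp add: eq_neg_iff_add_eq_0 add.commute)
qed

lemma one_pm_not_nonpos_Real: "norm x < 1 \<Longrightarrow> 1 - x \<notin> \<real>\<^sub>\<le>\<^sub>0" "norm x < 1 \<Longrightarrow> 1 + x \<notin> \<real>\<^sub>\<le>\<^sub>0"
  for x :: complex
  using abs_Re_le_cmod[of x] by (auto simp: complex_nonpos_Reals_iff)

lemma arctan_sin_integral_derivative_eq: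
  assumes r: "norm r < 1" "r \<noteq> 0"
  shows "integral {0..pi/2} (\<lambda>s. 2 * (1 + r\<^sup>2) / (1 - r\<^sup>2)\<^sup>2 * of_real (sin s) / (1 + (tan_double r * of_real (sin s))\<^sup>2))
    = (Ln (1 + r) - Ln (1 - r)) / r"
proof -
  \<comment> \<open>The integrand is \<open>sin s / (1 + r\<^sup>2 - 2r cos s) + sin s / (1 + r\<^sup>2 + 2r cos s)\<close>, and
      \<open>1 + r\<^sup>2 - 2r cos s = (1 - r exp(i s)) (1 - r exp(-i s))\<close>.\<close>
  define P where "P s = (Ln (1 - r * exp (\<i> * s)) + Ln (1 - r * exp (- \<i> * s))
    - Ln (1 - (- r) * exp (\<i> * s)) - Ln (1 - (- r) * exp (- \<i> * s))) / (2 * r)" for s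
  have D: "((\<lambda>s. Ln (1 - a * exp (b * s))) has_field_derivative
      - (a * (b * exp (b * z))) / (1 - a * exp (b * z))) (at z)"
    if "1 - a * exp (b * z) \<notin> \<real>\<^sub>\<le>\<^sub>0" for a b z
    using that by (auto intro!: derivative_eq_intros simp: divide_inverse)
  have "((\<lambda>s. 2 * (1 + r\<^sup>2) / (1 - r\<^sup>2)\<^sup>2 * of_real (sin s) / (1 + (tan_double r * of_real (sin s))\<^sup>2))
      has_integral P (of_real (pi/2)) - P (of_real 0)) {0..pi/2}"
  proof (rule fundamental_theorem_of_calculus)
    fix s :: real assume "s \<in> {0..pi/2}"
    define e where "e = exp (\<i> * of_real s)"
    have e': "exp (- \<i> * of_real s) = inverse e" by (simp add: e_def exp_minus)
    have ne: "norm e = 1" by (simp add: e_def)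
    then have e0: "e \<noteq> 0" by auto
    \<comment> \<open>Since |e| = 1, all four logarithms have arguments 1 + x with |x| < 1, away
      from the cut, so \<open>P\<close> is differentiable along the whole interval.\<close>
    have lt: "norm (r * e) < 1" "norm (r * inverse e) < 1"
      using r ne by (simp_all add: norm_mult norm_inverse)
    note ln = one_pm_not_nonpos_Real[OF lt(1)] one_pm_not_nonpos_Real[OF lt(2)]
    have nz: "1 - r * e \<noteq> 0" "1 + r * e \<noteq> 0" "1 - r * inverse e \<noteq> 0" "1 + r * inverse e \<noteq> 0"
      using ln by (metis nonpos_Reals_zero_I)+
    have nz2: "1 - r\<^sup>2 \<noteq> 0" using r by (intro one_minus_square_nonzero)
    have sin_e: "complex_of_real (sin s) = (e - inverse e) / (2 * \<i>)"
      by (simp add: sin_of_real[symmetric] sin_exp_eq e_def exp_minus)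
    have "(P has_field_derivative
       (- (r * (\<i> * e)) / (1 - r * e) + (r * (\<i> * inverse e)) / (1 - r * inverse e)
        - (r * (\<i> * e)) / (1 + r * e) + (r * (\<i> * inverse e)) / (1 + r * inverse e)) / (2 * r)) (at (of_real s))"
      unfolding P_def
      by (rule DERIV_cong[OF DERIV_cdivide[OF DERIV_diff[OF DERIV_diff[OF DERIV_add[OF D D] D] D]]];
          (unfold e' e_def[symmetric])?; use ln in simp)
    also have "(- (r * (\<i> * e)) / (1 - r * e) + (r * (\<i> * inverse e)) / (1 - r * inverse e)
        - (r * (\<i> * e)) / (1 + r * e) + (r * (\<i> * inverse e)) / (1 + r * inverse e)) / (2 * r)
      = 2 * (1 + r\<^sup>2) / (1 - r\<^sup>2)\<^sup>2 * of_real (sin s) / (1 + (tan_double r * of_real (sin s))\<^sup>2)" (is "?L = ?R")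
    proof -
      \<comment> \<open>The product (1 - r^2 e^2)(1 - r^2 / e^2), the common denominator of both
        sides once (1 - r^2)^2 is cleared.\<close>
      define D where "D = (1 - r * e) * (1 + r * e) * ((1 - r * inverse e) * (1 + r * inverse e))"
      have D0: "D \<noteq> 0" using nz by (simp add: D_def)
      have DD: "(1 - r\<^sup>2)\<^sup>2 * (1 + (tan_double r * of_real (sin s))\<^sup>2) = D"
      proof -
        have "(1 - r\<^sup>2)\<^sup>2 * (1 + (tan_double r * of_real (sin s))\<^sup>2) = (1 - r\<^sup>2)\<^sup>2 + (2 * r * of_real (sin s))\<^sup>2"
          using nz2 by (simp add: tan_double_def power_mult_distrib power_divide field_simps)
        also have "\<dots> = (1 - r\<^sup>2)\<^sup>2 - r\<^sup>2 * (e - inverse e)\<^sup>2"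
          by (simp add: sin_e power_mult_distrib power_divide)
        also have "\<dots> = D"
          using e0 by (simp add: D_def field_simps power2_eq_square)
        finally show ?thesis .
      qed
      have R: "?R = 2 * (1 + r\<^sup>2) * of_real (sin s) / D"
        by (simp only: DD[symmetric] times_divide_eq_left divide_divide_eq_left)
      have L: "?L = \<i> * (inverse e - e) * (1 + r\<^sup>2) / D"
      proof -
        have gen: "c / (1 - x) + c / (1 + x) = 2 * c / ((1 - x) * (1 + x))"
          if "1 - x \<noteq> 0" "1 + x \<noteq> 0" for c x :: complex
          using that by (simp add: add_frac_eq algebra_simps)
        have "- (r * (\<i> * e)) / (1 - r * e) - (r * (\<i> * e)) / (1 + r * e)
            = - 2 * r * \<i> * e / ((1 - r * e) * (1 + r * e))"
          using gen[OF nz(1,2), of "- (r * (\<i> * e))"] by simp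
        moreover have "(r * (\<i> * inverse e)) / (1 - r * inverse e) + (r * (\<i> * inverse e)) / (1 + r * inverse e)
            = 2 * r * \<i> * inverse e / ((1 - r * inverse e) * (1 + r * inverse e))"
          using gen[OF nz(3,4), of "r * (\<i> * inverse e)"] by simp
        ultimately have "?L = (- 2 * r * \<i> * e / ((1 - r * e) * (1 + r * e)) +
            2 * r * \<i> * inverse e / ((1 - r * inverse e) * (1 + r * inverse e))) / (2 * r)"
          by (simp add: algebra_simps)
        also have "\<dots> = \<i> * inverse e / ((1 - r * inverse e) * (1 + r * inverse e))
            - \<i> * e / ((1 - r * e) * (1 + r * e))"
          using r by (simp add: add_divide_distrib diff_divide_distrib)
        also have "\<dots> = (\<i> * inverse e * ((1 - r * e) * (1 + r * e))
            - \<i> * e * ((1 - r * inverse e) * (1 + r * inverse e))) / D"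
          using nz unfolding D_def by (subst diff_frac_eq) (simp_all add: mult_ac)
        also have "\<i> * inverse e * ((1 - r * e) * (1 + r * e))
            - \<i> * e * ((1 - r * inverse e) * (1 + r * inverse e)) = \<i> * (inverse e - e) * (1 + r\<^sup>2)"
          using e0 by (simp add: field_simps power2_eq_square)
        finally show ?thesis .
      qed
      have S: "\<i> * (inverse e - e) = 2 * complex_of_real (sin s)"
        by (simp only: sin_e divide_numeral_i) (simp add: right_diff_distrib)
      show ?thesis unfolding L R S by simp
    qed
    finally show "((\<lambda>s. P (of_real s)) has_vector_derivative
        2 * (1 + r\<^sup>2) / (1 - r\<^sup>2)\<^sup>2 * of_real (sin s) / (1 + (tan_double r * of_real (sin s))\<^sup>2)) (at s within {0..pi/2})"
      by (rule has_vector_derivative_real_field)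
  qed simp
  moreover have "P (of_real (pi/2)) - P (of_real 0) = (Ln (1 + r) - Ln (1 - r)) / r"
  proof -
    \<comment> \<open>At s = pi/2 the exponentials are i and -i, so the four logarithms cancel in
      pairs.\<close>
    have e: "exp (\<i> * of_real (pi/2)) = \<i>"
      by (simp only: cis_conv_exp[symmetric] cis_pi_half)
    have "exp (- \<i> * of_real (pi/2)) = inverse (exp (\<i> * of_real (pi/2)))"
      by (simp only: exp_minus mult_minus_left)
    with e have "exp (- \<i> * of_real (pi/2)) = - \<i>"
      by (simp only: inverse_i)
    with e have "P (of_real (pi/2)) = 0" by (simp only: P_def) simp
    moreover have "P (of_real 0) = - ((Ln (1 + r) - Ln (1 - r)) / r)"
      using r by (simp add: P_def field_simps)
    ultimately show ?thesis by simp
  qed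
  ultimately show ?thesis by (simp add: integral_unique)
qed

text \<open>Both sides have the derivative (Ln(1 + r) - Ln(1 - r))/r for r other than 0, and both
  vanish at 0.\<close>

lemma arctan_sin_integral_eq:
  assumes "norm r < 1"
  shows "arctan_sin_integral (tan_double r) = polylog 2 r - polylog 2 (- r)"
proof -
  define f' where "f' r s = 2 * (1 + r\<^sup>2) / (1 - r\<^sup>2)\<^sup>2 * of_real (sin s) / (1 + (tan_double r * of_real (sin s))\<^sup>2)" for r s
  have dom: "tan_double r * of_real (sin s) \<in> arctan_domain" if "norm r < 1" for r s
    using that by (intro arctan_domain_scale tan_double_in_arctan_domain) auto
  have cA: "continuous_on arctan_domain Arctan"
    by (rule continuous_on_Arctan) (auto simp: mem_arctan_domain)
  have D: "((\<lambda>r. arctan_sin_integral (tan_double r)) has_field_derivative integral {0..pi/2} (f' r)) (at r)"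
    if r: "norm r < 1" for r
  proof -
    have "((\<lambda>r. integral (cbox 0 (pi/2)) (\<lambda>s. Arctan (tan_double r * of_real (sin s)))) has_field_derivative
        integral (cbox 0 (pi/2)) (f' r)) (at r within ball 0 1)"
    proof (rule leibniz_rule_field_derivative)
      fix x :: complex and s :: real assume x: "x \<in> ball 0 1"
      show "((\<lambda>r. Arctan (tan_double r * of_real (sin s))) has_field_derivative f' x s) (at x within ball 0 1)"
        unfolding f'_def using x dom[of x s]
        by (intro has_field_derivative_Arctan' DERIV_cmult_right has_field_derivative_tan_double) auto
      show "(\<lambda>s. Arctan (tan_double x * of_real (sin s))) integrable_on cbox 0 (pi/2)"
        using x dom[of x] unfolding cbox_interval
        by (intro integrable_continuous_real continuous_on_compose2[OF cA] continuous_intros) auto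
    next
      have td: "continuous_on (ball 0 1 \<times> {0..pi/2}) (\<lambda>p. tan_double (fst p))"
        by (rule continuous_on_compose2[OF continuous_on_tan_double]) (auto intro!: continuous_intros)
      have "continuous_on (ball 0 1 \<times> {0..pi/2}) (\<lambda>p. f' (fst p) (snd p))"
        unfolding f'_def
        using one_minus_square_nonzero dom arctan_domain_nonzero
        by (intro continuous_intros td) auto
      then show "continuous_on (ball 0 1 \<times> cbox 0 (pi/2)) (\<lambda>(x, t). f' x t)"
        by (simp add: case_prod_unfold)
    qed (use r in auto)
    then show ?thesis
      using r by (simp add: at_within_open[of r "ball 0 1"] arctan_sin_integral_def)
  qed
  define h where "h r = arctan_sin_integral (tan_double r) - (polylog 2 r - polylog 2 (- r))" for r
  have ball: "r \<in> slit_plane" "- r \<in> slit_plane" if "norm r < 1" for r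
    using that ball_subset_slit_plane by auto
  have "isCont h r" if "norm r < 1" for r
  proof -
    have "isCont (\<lambda>r. polylog 2 (- r)) r"
      by (rule isCont_o2[where f = uminus]) (use ball[OF that] isCont_polylog in auto)
    then show ?thesis
      unfolding h_def using DERIV_isCont[OF D[OF that]] isCont_polylog[OF ball(1)[OF that]]
      by (intro continuous_diff)
  qed
  then have cont: "continuous_on (ball 0 1) h" by (simp add: continuous_at_imp_continuous_on)
  obtain d where d: "\<And>z. z \<in> ball 0 1 \<Longrightarrow> h z = d"
  proof (rule DERIV_zero_connected_constant[of "ball 0 1" "{0}" h])
    show "\<forall>x\<in>ball 0 1 - {0}. DERIV h x :> 0"
    proof
      fix x :: complex assume "x \<in> ball 0 1 - {0}"
      then have x: "norm x < 1" "x \<noteq> 0" by auto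
      have "((\<lambda>r. polylog 2 r - polylog 2 (- r)) has_field_derivative (Ln (1 + x) - Ln (1 - x)) / x) (at x)"
        using x ball[OF x(1)]
        by (auto intro!: derivative_eq_intros simp: diff_divide_distrib)
      moreover have "((\<lambda>r. arctan_sin_integral (tan_double r)) has_field_derivative (Ln (1 + x) - Ln (1 - x)) / x) (at x)"
        using D[OF x(1)] arctan_sin_integral_derivative_eq[OF x] by (simp add: f'_def[abs_def])
      ultimately show "DERIV h x :> 0"
        unfolding h_def by (auto intro: DERIV_diff[THEN DERIV_cong])
    qed
  qed (use cont in auto)
  have "d = 0" using d[of 0] by (simp add: h_def arctan_sin_integral_def tan_double_def)
  then show ?thesis using d[of r] assms by (simp add: h_def)
qed

text \<open>By the chain rule the derivative is \<open>v K'(v)\<close>, which is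
  \<open>- H(v)\<close>, times the logarithmic derivative (1 + r^2)/(r(1 - r^2)) of
  \<open>tan_double\<close>.\<close>

lemma has_field_derivative_TS_reduced_polylog:
  assumes "norm r < 1" "r \<noteq> 0"
  shows "((\<lambda>r. TS_reduced (tan_double r)) has_field_derivative
     - (1 + r\<^sup>2) / (r * (1 - r\<^sup>2)) * (polylog 2 r - polylog 2 (- r))) (at r)"
proof -
  have nz: "1 - r\<^sup>2 \<noteq> 0" using assms by (intro one_minus_square_nonzero)
  have "tan_double r * TS_kernel (tan_double r) = - (polylog 2 r - polylog 2 (- r))"
    using TS_kernel_eq[OF tan_double_in_arctan_domain] arctan_sin_integral_eq assms by simp
  moreover have "2 * (1 + r\<^sup>2) / (1 - r\<^sup>2)\<^sup>2 = (1 + r\<^sup>2) / (r * (1 - r\<^sup>2)) * tan_double r"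
    using nz assms by (simp add: tan_double_def power2_eq_square)
  ultimately have "2 * (1 + r\<^sup>2) / (1 - r\<^sup>2)\<^sup>2 * TS_kernel (tan_double r) =
      - (1 + r\<^sup>2) / (r * (1 - r\<^sup>2)) * (polylog 2 r - polylog 2 (- r))"
    by (simp only: mult.assoc minus_divide_left[symmetric] mult_minus_left mult_minus_right)
  then show ?thesis using has_field_derivative_TS_reduced[OF assms(1)] by simp
qed

text \<open>\<open>TS_kernel\<close> is even in v, so the sum of the values at r and -r has
  derivative zero; it vanishes at 0.\<close>

lemma TS_reduced_odd:
  assumes "norm r < 1"
  shows "TS_reduced (tan_double (- r)) = - TS_reduced (tan_double r)"
proof -
  define h where "h r = TS_reduced (tan_double r) + TS_reduced (tan_double (- r))" for r
  have neg: "tan_double (- r) = - tan_double r" for r by (simp add: tan_double_def)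
  have ker: "TS_kernel (- v) = TS_kernel v" for v by (simp add: TS_kernel_def)
  have "(h has_field_derivative 0) (at x within ball 0 1)" if "x \<in> ball 0 1" for x
  proof -
    have x: "norm x < 1" "norm (- x) < 1" using that by auto
    have "((\<lambda>r. TS_reduced (tan_double (- r))) has_field_derivative
        2 * (1 + x\<^sup>2) / (1 - x\<^sup>2)\<^sup>2 * TS_kernel (tan_double x) * -1) (at x)"
      using DERIV_chain[OF has_field_derivative_TS_reduced[OF x(2)] DERIV_minus[OF DERIV_ident]]
      by (simp add: o_def neg ker)
    from DERIV_add[OF has_field_derivative_TS_reduced[OF x(1)] this]
    have "(h has_field_derivative 0) (at x)" unfolding h_def by simp
    then show ?thesis by (rule has_field_derivative_at_within)
  qed
  then obtain c where c: "\<forall>x\<in>ball 0 1. h x = c"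
    using has_field_derivative_zero_constant[of "ball 0 1" h] by auto
  have "c = 0" using bspec[OF c, of 0] by (simp add: h_def TS_reduced_def tan_double_def)
  then show ?thesis using bspec[OF c, of r] assms
    by (simp add: h_def eq_neg_iff_add_eq_0 add.commute)
qed

lemma TS_reduced_holomorphic: "(\<lambda>r. TS_reduced (tan_double r)) holomorphic_on ball 0 1"
  using has_field_derivative_TS_reduced by (force simp: holomorphic_on_open)


section \<open>The closed form\<close>

text \<open>It suffices to exhibit one odd holomorphic function on the disc that matches
  \<open>F\<close> off the slit; the identity theorem on the open slit disc makes it unique.\<close>

lemma odd_disc_value_eqI:
  assumes g: "g holomorphic_on ball 0 1"
    and odd: "\<And>z. norm z < 1 \<Longrightarrow> g (- z) = - g z"
    and eq: "\<And>z. z \<in> slit_disc \<Longrightarrow> F z = g z"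
    and r: "norm r < 1"
  shows "odd_disc_value F r = g r"
proof (cases "r \<in> complex_of_real ` {-1<..0}")
  case False
  then show ?thesis using eq[of r] r by (simp add: odd_disc_value_def slit_disc_def)
next
  case True
  have "(THE y. \<exists>h. h holomorphic_on ball 0 1 \<and>
                       (\<forall>z\<in>ball 0 1. h (- z) = - h z) \<and>
                       (\<forall>z\<in>slit_disc. h z = F z) \<and>
                       y = h r) = g r"
  proof (rule the_equality)
    show "\<exists>h. h holomorphic_on ball 0 1 \<and> (\<forall>z\<in>ball 0 1. h (- z) = - h z) \<and>
        (\<forall>z\<in>slit_disc. h z = F z) \<and> g r = h r"
      by (rule exI[of _ g]) (use g odd eq in auto)
    fix y assume "\<exists>h. h holomorphic_on ball 0 1 \<and> (\<forall>z\<in>ball 0 1. h (- z) = - h z) \<and>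
        (\<forall>z\<in>slit_disc. h z = F z) \<and> y = h r"
    then obtain h where h: "h holomorphic_on ball 0 1" "\<forall>z\<in>slit_disc. h z = F z" and y: "y = h r"
      by (elim exE conjE)
    have "1/2 \<in> slit_disc" by (simp add: mem_slit_disc)
    then have ne: "slit_disc \<noteq> {}" by blast
    have sub: "slit_disc \<subseteq> ball 0 1" by (simp add: slit_disc_def)
    have "h r = g r"
      by (rule analytic_continuation_open[OF open_slit_disc open_ball ne connected_ball sub h(1) g])
         (use h(2) eq r in auto)
    then show "y = g r" using y by simp
  qed
  then show ?thesis using True by (simp add: odd_disc_value_def slit_disc_def)
qed

section \<open>The polylogarithmic formula as a function of r\<close>

lemma Re_one_plus_minus_pos:
  assumes "norm z < 1" shows "Re (1 + z) > 0" "Re (1 - z) > 0"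
  using assms abs_Re_le_cmod[of z] by auto

text \<open>Both 1 + z and 1 - z lie in the right half-plane, so their arguments stay below pi/2 in
  modulus and adding or subtracting them does not leave the principal strip.\<close>

lemma Ln_one_plus_minus:
  assumes "norm z < 1"
  shows "Ln ((1 + z) / (1 - z)) = Ln (1 + z) - Ln (1 - z)"
    and "Ln (1 - z\<^sup>2) = Ln (1 + z) + Ln (1 - z)"
proof -
  have nz: "1 + z \<noteq> 0" "1 - z \<noteq> 0"
    using Re_one_plus_minus_pos[OF assms] by (auto simp: complex_eq_iff)
  have "\<bar>Im (Ln (1 + z))\<bar> < pi / 2" "\<bar>Im (Ln (1 - z))\<bar> < pi / 2"
    using Re_one_plus_minus_pos[OF assms] Re_Ln_pos_lt_imp by blast+
  then show "Ln ((1 + z) / (1 - z)) = Ln (1 + z) - Ln (1 - z)"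
    and "Ln (1 - z\<^sup>2) = Ln (1 + z) + Ln (1 - z)"
    using nz by (intro Ln_unique; simp add: exp_diff exp_add algebra_simps power2_eq_square)+
qed

text \<open>The logarithm of the quotient is split in advance, so that each factor has a one-term
  derivative.\<close>

definition TS_polylog :: "complex \<Rightarrow> complex" where
  "TS_polylog z = - 1 / 4 * polylog 3 (z\<^sup>2) - 2 * polylog 3 (1 - z) - 2 * polylog 3 (z / (1 + z))
     + 2 * zeta_nat 3 + 1 / 2 * (Ln (1 + z) - Ln (1 - z)) * polylog 2 (z\<^sup>2)
     + of_real pi ^ 2 / 3 * Ln (1 - z) + 1 / 3 * Ln (1 + z) ^ 3 - Ln z * Ln (1 - z) ^ 2"

text \<open>Duplication, Landen's formula at -z and reflection express every dilogarithm in the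
  derivative through Li_2(z), Li_2(-z) and logarithms. What remains is a polynomial identity in
  these and in \<open>a\<close>, \<open>b\<close>, \<open>c\<close>.\<close>

lemma has_field_derivative_TS_polylog:
  assumes zs: "z \<in> slit_disc"
  shows "(TS_polylog has_field_derivative
     - (1 + z\<^sup>2) / (z * (1 - z\<^sup>2)) * (polylog 2 z - polylog 2 (- z))) (at z)"
proof -
  note z = slit_disc_subset[OF zs]
  have lt: "norm z < 1" using z(1) by simp
  have nz: "1 - z \<noteq> 0" "1 + z \<noteq> 0"
    using z(6,7) by (metis nonpos_Reals_zero_I)+
  define a b c where "a = inverse z" "b = inverse (1 - z)" "c = inverse (1 + z)"
  have z2: "z\<^sup>2 \<in> slit_plane" "z\<^sup>2 \<noteq> 0"
    using lt z(8) ball_subset_slit_plane by (auto simp: norm_power abs_square_less_1)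
  have dup: "polylog 2 (z\<^sup>2) = 2 * (polylog 2 z + polylog 2 (- z))"
    by (simp only: polylog_duplication[OF z(1)]) simp
  have "- z - 1 = - (1 + z)" by simp
  then have w: "- z / (- z - 1) = z / (1 + z)" by (simp only: minus_divide_divide)
  have wsp: "z / (1 + z) \<in> slit_plane" using slit_plane_moebius[OF z(3)] by (simp only: w)
  have lan: "polylog 2 (z / (1 + z)) = - polylog 2 (- z) - Ln (1 + z) ^ 2 / 2"
    using dilog_landen[OF z(3)] unfolding w by simp
  have d1: "((\<lambda>z. polylog 3 (z\<^sup>2)) has_field_derivative 2 * a * polylog 2 (z\<^sup>2)) (at z)"
    using z(8) z2 by (auto intro!: derivative_eq_intros simp: a_b_c_def field_simps power2_eq_square)
  have d2: "((\<lambda>z. polylog 3 (1 - z)) has_field_derivative - polylog 2 (1 - z) * b) (at z)"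
    using z nz by (auto intro!: derivative_eq_intros simp: a_b_c_def divide_inverse)
  have "((\<lambda>z. z / (1 + z)) has_field_derivative 1 / (1 + z)\<^sup>2) (at z)"
    using nz by (auto intro!: derivative_eq_intros simp: power2_eq_square)
  then have "((\<lambda>z. polylog 3 (z / (1 + z))) has_field_derivative
      polylog 2 (z / (1 + z)) / (z / (1 + z)) * (1 / (1 + z)\<^sup>2)) (at z)"
    using wsp z(8) nz by (intro has_field_derivative_polylog_3) auto
  moreover have "X / (z / (1 + z)) * (1 / (1 + z)\<^sup>2) = X * (a - c)" for X
    using z(8) nz unfolding a_b_c_def by (simp add: divide_simps power2_eq_square)
  ultimately have d3: "((\<lambda>z. polylog 3 (z / (1 + z))) has_field_derivative
      polylog 2 (z / (1 + z)) * (a - c)) (at z)" by simp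
  have d4: "((\<lambda>z. polylog 2 (z\<^sup>2)) has_field_derivative - 2 * a * (Ln (1 + z) + Ln (1 - z))) (at z)"
    using z(8) z2 Ln_one_plus_minus(2)[OF lt]
    by (auto intro!: derivative_eq_intros simp: a_b_c_def field_simps power2_eq_square)
  have d5: "(Ln has_field_derivative a) (at z)"
    using z by (auto intro!: derivative_eq_intros simp: a_b_c_def)
  have d6: "((\<lambda>z. Ln (1 - z)) has_field_derivative - b) (at z)"
    using z by (auto intro!: derivative_eq_intros simp: a_b_c_def divide_inverse)
  have d7: "((\<lambda>z. Ln (1 + z)) has_field_derivative c) (at z)"
    using z by (auto intro!: derivative_eq_intros simp: a_b_c_def divide_inverse)
  have "1 - z\<^sup>2 = (1 - z) * (1 + z)" by (simp add: algebra_simps power2_eq_square)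
  then have target: "- (1 + z\<^sup>2) / (z * (1 - z\<^sup>2)) = - a - b + c"
    using z(8) nz unfolding a_b_c_def by (simp add: divide_simps) (simp add: algebra_simps power2_eq_square)
  show ?thesis
    unfolding TS_polylog_def[abs_def] target
    apply (rule DERIV_cong)
     apply (rule d1 d2 d3 d4 d5 d6 d7 DERIV_const DERIV_add DERIV_diff DERIV_cmult DERIV_mult DERIV_power)+
    apply (simp add: lan dup dilog_reflection[OF zs])
    apply (simp add: algebra_simps power2_eq_square add_divide_distrib diff_divide_distrib)
    done
qed

text \<open>Equal derivatives leave a constant. At 0+ the term -2 Li_3(1 - z) cancels 2 zeta(3), and
  every other term tends to 0, including the one with Ln z.\<close>

lemma TS_polylog_eq:
  assumes "z \<in> slit_disc"
  shows "TS_polylog z = TS_reduced (tan_double z)"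
proof -
  have "TS_polylog z - TS_reduced (tan_double z) = 0"
  proof (rule constant_on_slit_disc[OF _ _ _ eventually_at_right_0_unit assms,
        where f = "\<lambda>z. TS_polylog z - TS_reduced (tan_double z)"])
    fix z assume z: "z \<in> slit_disc"
    from DERIV_diff[OF has_field_derivative_TS_polylog[OF z] has_field_derivative_TS_reduced_polylog]
    show "((\<lambda>z. TS_polylog z - TS_reduced (tan_double z)) has_field_derivative 0) (at z)"
      using slit_disc_subset[OF z] by simp
  next
    have "((\<lambda>x. TS_reduced (tan_double (complex_of_real x))) \<longlongrightarrow> TS_reduced (tan_double 0)) (at_right 0)"
      by (rule isCont_tendsto_compose[OF DERIV_isCont[OF has_field_derivative_TS_reduced]])
         (auto intro!: tendsto_eq_intros)
    then have 0: "((\<lambda>x. TS_reduced (tan_double (complex_of_real x))) \<longlongrightarrow> 0) (at_right 0)"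
      by (simp add: TS_reduced_def tan_double_def)
    have "((\<lambda>x::real. pi ^ 2 / 3 * ln (1 - x) + 1 / 3 * ln (1 + x) ^ 3 - ln x * ln (1 - x) ^ 2) \<longlongrightarrow> 0) (at_right 0)"
      by real_asymp
    then have 1: "((\<lambda>x. complex_of_real (pi ^ 2 / 3 * ln (1 - x) + 1 / 3 * ln (1 + x) ^ 3 - ln x * ln (1 - x) ^ 2))
        \<longlongrightarrow> of_real 0) (at_right 0)"
      by (rule tendsto_of_real)
    have "((\<lambda>x::real. 1 / 2 * (ln (1 + x) - ln (1 - x))) \<longlongrightarrow> 0) (at_right 0)"
      by real_asymp
    then have 2: "((\<lambda>x. complex_of_real (1 / 2 * (ln (1 + x) - ln (1 - x)))) \<longlongrightarrow> of_real 0) (at_right 0)"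
      by (rule tendsto_of_real)
    have 3: "((\<lambda>x. polylog k ((complex_of_real x)\<^sup>2)) \<longlongrightarrow> 0) (at_right 0)" for k
      by (rule tendsto_polylog_at_0) (auto intro!: tendsto_eq_intros)
    have 4: "((\<lambda>x. polylog 3 (complex_of_real x / (1 + complex_of_real x))) \<longlongrightarrow> 0) (at_right 0)"
      by (rule tendsto_polylog_at_0) (auto intro!: tendsto_eq_intros)
    have 5: "((\<lambda>x. polylog 3 (of_real (1 - x))) \<longlongrightarrow> zeta_nat 3) (at_right 0)"
    proof (rule tendsto_polylog_at_1)
      show "((\<lambda>x::real. 1 - x) \<longlongrightarrow> 1) (at_right 0)" by real_asymp
      show "\<forall>\<^sub>F x in at_right 0. 0 < 1 - x \<and> 1 - x < (1::real)"
        using eventually_at_right_0_unit by eventually_elim auto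
    qed simp
    have "((\<lambda>x. - 1 / 4 * polylog 3 ((complex_of_real x)\<^sup>2) - 2 * polylog 3 (of_real (1 - x))
        - 2 * polylog 3 (complex_of_real x / (1 + complex_of_real x)) + 2 * zeta_nat 3
        + complex_of_real (1 / 2 * (ln (1 + x) - ln (1 - x))) * polylog 2 ((complex_of_real x)\<^sup>2)
        + complex_of_real (pi ^ 2 / 3 * ln (1 - x) + 1 / 3 * ln (1 + x) ^ 3 - ln x * ln (1 - x) ^ 2)
        - TS_reduced (tan_double (complex_of_real x)))
      \<longlongrightarrow> - 1 / 4 * 0 - 2 * zeta_nat 3 - 2 * 0 + 2 * zeta_nat 3 + of_real 0 * 0 + of_real 0 - 0) (at_right 0)"
      by (intro tendsto_add tendsto_diff tendsto_mult tendsto_const 0 1 2 3 4 5)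
    moreover have "\<forall>\<^sub>F x in at_right 0. - 1 / 4 * polylog 3 ((complex_of_real x)\<^sup>2) - 2 * polylog 3 (of_real (1 - x))
        - 2 * polylog 3 (complex_of_real x / (1 + complex_of_real x)) + 2 * zeta_nat 3
        + complex_of_real (1 / 2 * (ln (1 + x) - ln (1 - x))) * polylog 2 ((complex_of_real x)\<^sup>2)
        + complex_of_real (pi ^ 2 / 3 * ln (1 - x) + 1 / 3 * ln (1 + x) ^ 3 - ln x * ln (1 - x) ^ 2)
        - TS_reduced (tan_double (complex_of_real x))
        = TS_polylog (of_real x) - TS_reduced (tan_double (of_real x))"
      using eventually_at_right_0_unit
    proof eventually_elim
      case (elim x)
      then show ?case using Ln_of_real[of x] Ln_of_real[of "1 - x"] Ln_of_real[of "1 + x"]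
        by (simp add: TS_polylog_def)
    qed
    ultimately have "((\<lambda>x. TS_polylog (of_real x) - TS_reduced (tan_double (of_real x)))
      \<longlongrightarrow> - 1 / 4 * 0 - 2 * zeta_nat 3 - 2 * 0 + 2 * zeta_nat 3 + of_real 0 * 0 + of_real 0 - 0) (at_right 0)"
      by (rule Lim_transform_eventually)
    then show "((\<lambda>x. TS_polylog (of_real x) - TS_reduced (tan_double (of_real x))) \<longlongrightarrow> 0) (at_right 0)"
      by simp
  qed simp
  then show ?thesis by simp
qed

section \<open>The special value at the inverse golden ratio\<close>

lemma TS_polylog_golden:
  assumes r: "0 < r" "r < 1" "r\<^sup>2 = 1 - r"
  shows "TS_polylog (of_real r) = - 7 / 5 * zeta_nat 3"
proof -
  define z where "z = complex_of_real r"
  define L where "L = Ln z"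
  have zs: "z \<in> slit_disc" using r by (simp add: z_def mem_slit_disc)
  \<comment> \<open>The equation r^2 = 1 - r collapses the arguments: r^2, 1 - r and r/(1 + r)
    coincide, 1/r = 1 + r, and all logarithms are multiples of \<open>L\<close>.\<close>
  note z = slit_disc_subset[OF zs]
  have "complex_of_real (r\<^sup>2) = of_real (1 - r)" by (simp only: r(3))
  then have z2: "z\<^sup>2 = 1 - z" by (simp add: z_def)
  have inv: "1 / z = 1 + z" using z2 z(8) by (simp add: field_simps power2_eq_square)
  have nz: "1 + z \<noteq> 0" using z(8) inv[symmetric] by simp
  have "z = (1 - z) * (1 + z)" using z2 by (simp add: algebra_simps power2_eq_square)
  then have w: "z / (1 + z) = 1 - z" unfolding nonzero_divide_eq_eq[OF nz] .
  have "- z - 1 = - (1 + z)" by simp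
  then have w': "- z / (- z - 1) = 1 - z" using w by (simp only: minus_divide_divide)
  have L1: "Ln (1 - z) = 2 * L"
  proof -
    have "1 - z = of_real (r * r)" using z2 by (simp add: z_def power2_eq_square)
    then show ?thesis using r Ln_of_real[of "r * r"] Ln_of_real[of r] ln_mult[of r r]
      by (simp add: L_def z_def)
  qed
  have L2: "Ln (1 + z) = - L"
    using Ln_inverse[OF z(5)] inv by (simp add: L_def inverse_eq_divide)
  define A B where "A = polylog 3 (1 - z)" "B = polylog 2 (1 - z)"
  have dup2: "polylog 2 z + polylog 2 (- z) = B / 2"
    using polylog_duplication[OF z(1), of 2] by (simp add: A_B_def z2)
  have dup3: "polylog 3 z + polylog 3 (- z) = A / 4"
    using polylog_duplication[OF z(1), of 3] by (simp add: A_B_def z2)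
  have refl: "B = of_real pi ^ 2 / 6 - polylog 2 z - 2 * L ^ 2"
    using dilog_reflection[OF zs] by (simp add: A_B_def L1 power2_eq_square flip: L_def)
  have lan: "B = - polylog 2 (- z) - L ^ 2 / 2"
    using dilog_landen[OF z(3)] unfolding w' by (simp add: A_B_def L2)
  \<comment> \<open>Adding reflection and Landen's formula brings in Li_2(z) + Li_2(-z), which
    duplication replaces by B/2, leaving a linear equation for \<open>B\<close>.\<close>
  have "B + B = of_real pi ^ 2 / 6 - (polylog 2 z + polylog 2 (- z)) - 5 / 2 * L ^ 2"
    by (subst (1) refl, subst lan) (simp add: algebra_simps)
  then have e: "B + B + B / 2 = of_real pi ^ 2 / 6 - 5 / 2 * L ^ 2"
    unfolding dup2 by simp
  have "B = 2 / 5 * (B + B + B / 2)" by simp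
  then have B: "B = of_real pi ^ 2 / 15 - L ^ 2"
    unfolding e by (simp add: right_diff_distrib)
  \<comment> \<open>Here 1 - 1/z = -z, so duplication turns the identity into a linear equation for
    \<open>A\<close>.\<close>
  have "polylog 3 z + A + polylog 3 (- z) = zeta_nat 3 + L ^ 3 / 6 + of_real pi ^ 2 / 6 * L - L ^ 2 * (2 * L) / 2"
    using trilog_landen[OF zs] unfolding inv L1 by (simp add: A_B_def L_def)
  then have e: "A / 4 + A = zeta_nat 3 + L ^ 3 / 6 + of_real pi ^ 2 / 6 * L - L ^ 3"
    using dup3 by (simp add: algebra_simps power2_eq_square power3_eq_cube)
  have "A = 4 / 5 * (A / 4 + A)" by simp
  then have A: "A = 4 / 5 * (zeta_nat 3 + L ^ 3 / 6 + of_real pi ^ 2 / 6 * L - L ^ 3)"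
    unfolding e .
  have "TS_polylog z = - 1 / 4 * A - 2 * A - 2 * A + 2 * zeta_nat 3 + 1 / 2 * (- L - 2 * L) * B
     + of_real pi ^ 2 / 3 * (2 * L) + 1 / 3 * (- L) ^ 3 - L * (2 * L) ^ 2"
    unfolding TS_polylog_def by (simp only: z2 w L1 L2 A_B_def L_def)
  \<comment> \<open>The terms in pi^2 L and L^3 cancel, and -17/4 times 4/5 plus 2 is -7/5.\<close>
  also have "\<dots> = - 7 / 5 * zeta_nat 3"
    unfolding A B by (simp add: field_simps power2_eq_square power3_eq_cube)
  finally show ?thesis by (simp add: z_def)
qed

theorem corollary4p6:
  shows
    "(\<forall>v r :: complex.
        v \<notin> {\<i> * of_real t | t :: real. \<bar>t\<bar> \<ge> 1} \<longrightarrow>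
        r = v / (1 + csqrt (1 + v\<^sup>2)) \<longrightarrow>
        TS v 1 =
          of_real pi / 2 * contour_integral (linepath 0 v) (\<lambda>u. Arctan u / u)
          + odd_disc_value
              (\<lambda>r. - 1 / 4 * polylog 3 (r\<^sup>2) - 2 * polylog 3 (1 - r)
                   - 2 * polylog 3 (r / (1 + r)) + 2 * zeta_nat 3
                   + 1 / 2 * Ln ((1 + r) / (1 - r)) * polylog 2 (r\<^sup>2)
                   + of_real pi ^ 2 / 3 * Ln (1 - r)
                   + 1 / 3 * Ln (1 + r) ^ 3
                   - Ln r * Ln (1 - r) ^ 2) r)
     \<and> TS 2 1 =
          of_real pi / 2 * contour_integral (linepath 0 2) (\<lambda>u. Arctan u / u)
          - 7 / 5 * zeta_nat 3"
proof (intro conjI allI impI)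
  fix v r :: complex
  assume "v \<notin> {\<i> * of_real t | t :: real. \<bar>t\<bar> \<ge> 1}" and r: "r = v / (1 + csqrt (1 + v\<^sup>2))"
  then have v: "v \<in> arctan_domain" by (simp add: arctan_domain_def)
  note rv = tan_double_inverse[OF v r]
  have "odd_disc_value
              (\<lambda>r. - 1 / 4 * polylog 3 (r\<^sup>2) - 2 * polylog 3 (1 - r)
                   - 2 * polylog 3 (r / (1 + r)) + 2 * zeta_nat 3
                   + 1 / 2 * Ln ((1 + r) / (1 - r)) * polylog 2 (r\<^sup>2)
                   + of_real pi ^ 2 / 3 * Ln (1 - r)
                   + 1 / 3 * Ln (1 + r) ^ 3
                   - Ln r * Ln (1 - r) ^ 2) r = TS_reduced (tan_double r)"
  \<comment> \<open>The odd continuation across the slit is \<open>TS_reduced\<close> after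
    \<open>tan_double\<close>.\<close>
  proof (rule odd_disc_value_eqI[OF TS_reduced_holomorphic TS_reduced_odd _ rv(1)])
    fix z assume z: "z \<in> slit_disc"
    then have "norm z < 1" by (simp add: mem_slit_disc)
    show "- 1 / 4 * polylog 3 (z\<^sup>2) - 2 * polylog 3 (1 - z)
                   - 2 * polylog 3 (z / (1 + z)) + 2 * zeta_nat 3
                   + 1 / 2 * Ln ((1 + z) / (1 - z)) * polylog 2 (z\<^sup>2)
                   + of_real pi ^ 2 / 3 * Ln (1 - z)
                   + 1 / 3 * Ln (1 + z) ^ 3
                   - Ln z * Ln (1 - z) ^ 2 = TS_reduced (tan_double z)"
      unfolding TS_polylog_eq[OF z, symmetric] TS_polylog_def Ln_one_plus_minus(1)[OF \<open>norm z < 1\<close>] ..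
  qed
  then show "TS v 1 =
          of_real pi / 2 * contour_integral (linepath 0 v) (\<lambda>u. Arctan u / u)
          + odd_disc_value
              (\<lambda>r. - 1 / 4 * polylog 3 (r\<^sup>2) - 2 * polylog 3 (1 - r)
                   - 2 * polylog 3 (r / (1 + r)) + 2 * zeta_nat 3
                   + 1 / 2 * Ln ((1 + r) / (1 - r)) * polylog 2 (r\<^sup>2)
                   + of_real pi ^ 2 / 3 * Ln (1 - r)
                   + 1 / 3 * Ln (1 + r) ^ 3
                   - Ln r * Ln (1 - r) ^ 2) r"
    using TS_1_right[OF v] rv(2) by simp
next
  \<comment> \<open>The value of v/(1 + sqrt(1 + v^2)) at v = 2, the positive root of r^2 + r =
    1.\<close>
  define r where "r = 2 / (1 + sqrt 5)"
  have pos: "1 + sqrt 5 > 0" by (simp add: add_pos_pos)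
  have "sqrt 5 > 1" by simp
  then have r: "0 < r" "r < 1" using pos by (simp_all add: r_def)
  have r2: "r\<^sup>2 = 1 - r"
  proof -
    have "(1 + sqrt 5)\<^sup>2 = 6 + 2 * sqrt 5" by (simp add: power2_eq_square algebra_simps)
    then have "4 = (1 + sqrt 5)\<^sup>2 - 2 * (1 + sqrt 5)" by simp
    then have "4 / (1 + sqrt 5)\<^sup>2 = 1 - 2 / (1 + sqrt 5)"
      using pos by (simp add: field_simps power2_eq_square)
    then show ?thesis by (simp add: r_def power_divide)
  qed
  have "tan_double (of_real r) = 2"
  proof -
    have "1 - (complex_of_real r)\<^sup>2 = of_real r" using r2 by (simp flip: of_real_power)
    then show ?thesis using r by (simp add: tan_double_def)
  qed
  moreover have "complex_of_real r \<in> slit_disc" using r by (simp add: mem_slit_disc)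
  ultimately have "TS_reduced 2 = - 7 / 5 * zeta_nat 3"
    using TS_polylog_eq TS_polylog_golden[OF r r2] by metis
  then show "TS 2 1 = of_real pi / 2 * contour_integral (linepath 0 2) (\<lambda>u. Arctan u / u)
      - 7 / 5 * zeta_nat 3"
    using TS_1_right[of 2] by (simp add: mem_arctan_domain)
qed

end
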